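(* Let $(X,\varphi,g)$ be a Riemannian $7$-manifold with holonomy contained in $G_2$ and let $\Sigma\subseteq X$ be an oriented $2$-dimensional submanifold, with associated unit normal field $\eta$ and rank-$4$ real vector bundle $W=(T_\Sigma\oplus\langle\eta\rangle)^\perp\to\Sigma$ with complex structure $\mathcal{J}v=\eta\times v$. The connection $\nabla^W$ on $W$ induced from the Levi-Civita connection on $X$ is Hermitian with respect to the complex structure $\mathcal{J}$ (i.e. $\nabla^W\mathcal{J}=0$) if and only if the second fundamental form $B$ of $\Sigma$ takes values in $W$.
   Context: Let $\varphi_0=\varepsilon^{123}+\varepsilon^1\wedge(\varepsilon^{45}-\varepsilon^{67})+\varepsilon^2\wedge(\varepsilon^{46}-\varepsilon^{75})+\varepsilon^3\wedge(\varepsilon^{47}-\varepsilon^{56})$ on $\mathbb{R}^7$, where $\{\varepsilon^i\}$ is the dual of the standard basis and $\varepsilon^{ij}=\varepsilon^i\wedge\varepsilon^j$, etc. A Riemannian $7$-manifold $(X,\varphi,g)$ with holonomy contained in $G_2$ is a $7$-manifold with a smooth $3$-form $\varphi$ such that at each point there is a basis $\{e_i\}$ of the tangent space with dual coframe $\{\varepsilon^i\}$ in which $\varphi$ has the form $\varphi_0$; $g$ is the metric determined by $\varphi$ (for which such bases $\{e_i\}$ are orthonormal), and $\varphi$ is parallel for the Levi-Civita connection of $g$. The vector cross product on each tangent space is defined by $g(u,v\times w)=\varphi(u,v,w)$. For an oriented surface $\Sigma\subseteq X$, $\eta$ is the unit vector field along $\Sigma$, normal to $\Sigma$, given by $\eta=u\times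 v$ for any oriented orthonormal basis $\{u,v\}$ of $T_p\Sigma$. $W$ is the sub-bundle of the normal bundle of $\Sigma$ orthogonal to $\eta$. It is a Hermitian bundle of complex rank $2$ with the metric induced by $g$ and the complex structure $g(\mathcal{J}v,w)=g(\eta\times v,w)=\varphi(\eta,v,w)$. The connection $\nabla^W$ is the orthogonal projection to $W$ of the Levi-Civita connection $\nabla^X$ of $g$ (restricted to $\Sigma$). The second fundamental form is $B(v,w)=(\nabla^X_vw)^N$ for $v,w$ tangent to $\Sigma$, where $N$ denotes the component normal to $\Sigma$. *)

theory Defs
  imports "HOL-Analysis.Analysis" "HOL-Library.Function_Algebras"
begin

section \<open>Smooth maps between Euclidean spaces\<close>

text \<open>The set is meant to be open; the derivatives are honest derivatives at interior points.\<close>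

fun Ck_on :: "nat \<Rightarrow> 'a::real_normed_vector set \<Rightarrow> ('a \<Rightarrow> 'b::real_normed_vector) \<Rightarrow> bool" where
  "Ck_on 0 S f \<longleftrightarrow> continuous_on S f"
| "Ck_on (Suc n) S f \<longleftrightarrow> (\<forall>x\<in>S. f differentiable (at x)) \<and>
     (\<forall>v. Ck_on n S (\<lambda>x. frechet_derivative f (at x) v))"

definition smooth_on :: "'a::real_normed_vector set \<Rightarrow> ('a \<Rightarrow> 'b::real_normed_vector) \<Rightarrow> bool" where
  "smooth_on S f \<longleftrightarrow> (\<forall>n. Ck_on n S f)"


section \<open>Smooth manifolds\<close>

text \<open>A chart is a pair of its domain and its coordinate map; the values of the
  coordinate map outside the domain are irrelevant. The manifold is the whole
  (Hausdorff, second countable) type \<^typ>\<open>'a\<close>, and its smooth structure is a maximal atlas.\<close>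

type_synonym ('a, 'n) chart = "'a set \<times> ('a \<Rightarrow> real ^ 'n)"

abbreviation chart_inv :: "('a, 'n) chart \<Rightarrow> real ^ 'n \<Rightarrow> 'a" where
  "chart_inv c \<equiv> inv_into (fst c) (snd c)"

definition is_chart :: "('a::topological_space, 'n::finite) chart \<Rightarrow> bool" where
  "is_chart c \<longleftrightarrow> open (fst c) \<and> open (snd c ` fst c) \<and>
     homeomorphism (fst c) (snd c ` fst c) (snd c) (chart_inv c)"

definition compatible :: "('a, 'n::finite) chart \<Rightarrow> ('a, 'n) chart \<Rightarrow> bool" where
  "compatible c d \<longleftrightarrow>
     smooth_on (snd c ` (fst c \<inter> fst d)) (snd d \<circ> chart_inv c) \<and>
     smooth_on (snd d ` (fst c \<inter> fst d)) (snd c \<circ> chart_inv d)"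

definition smooth_structure ::
  "('a::{t2_space, second_countable_topology}, 'n::finite) chart set \<Rightarrow> bool" where
  "smooth_structure A \<longleftrightarrow>
     (\<forall>c\<in>A. is_chart c) \<and> (\<Union>c\<in>A. fst c) = UNIV \<and>
     (\<forall>c\<in>A. \<forall>d\<in>A. compatible c d) \<and>
     (\<forall>c. is_chart c \<and> (\<forall>d\<in>A. compatible c d) \<longrightarrow> c \<in> A)"

definition smooth_fun :: "('a, 'n::finite) chart set \<Rightarrow> 'a set \<Rightarrow> ('a \<Rightarrow> real) \<Rightarrow> bool" where
  "smooth_fun A U f \<longleftrightarrow>
     (\<forall>c\<in>A. smooth_on (snd c ` (fst c \<inter> U)) (\<lambda>x. f (chart_inv c x)))"


section \<open>Tangent vectors and vector fields\<close>

instantiation "fun" :: (type, real_vector) real_vector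
begin

definition scaleR_fun :: "real \<Rightarrow> ('a \<Rightarrow> 'b) \<Rightarrow> 'a \<Rightarrow> 'b" where
  "scaleR_fun r f = (\<lambda>x. r *\<^sub>R f x)"

instance
  by standard (auto simp: scaleR_fun_def fun_eq_iff scaleR_add_right scaleR_add_left)

end

text \<open>A tangent vector at a point is the family of its component vectors in all charts
  around the point, related by the Jacobians of the coordinate changes. The component in a chart
  not containing the point is set to 0, so that the tangent space is a linear subspace of the
  function space.\<close>

type_synonym ('a, 'n) tvec = "('a, 'n) chart \<Rightarrow> real ^ 'n"

definition tangent_space ::
  "('a, 'n::finite) chart set \<Rightarrow> 'a \<Rightarrow> ('a, 'n) tvec set" where
  "tangent_space A p = {v. \<forall>c.
     if c \<in> A \<and> p \<in> fst c
     then \<forall>d\<in>A. p \<in> fst d \<longrightarrow>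
            v d = frechet_derivative (snd d \<circ> chart_inv c) (at (snd c p)) (v c)
     else v c = 0}"

text \<open>The derivative of a function at a point along a tangent vector (the same in all charts).\<close>

definition dir_deriv ::
  "('a, 'n::finite) chart set \<Rightarrow> 'a \<Rightarrow> ('a, 'n) tvec \<Rightarrow> ('a \<Rightarrow> real) \<Rightarrow> real" where
  "dir_deriv A p v f =
     (let c = (SOME c. c \<in> A \<and> p \<in> fst c)
      in frechet_derivative (\<lambda>x. f (chart_inv c x)) (at (snd c p)) (v c))"

definition vector_field ::
  "('a, 'n::finite) chart set \<Rightarrow> 'a set \<Rightarrow> ('a \<Rightarrow> ('a, 'n) tvec) \<Rightarrow> bool" where
  "vector_field A U V \<longleftrightarrow>
     (\<forall>p\<in>U. V p \<in> tangent_space A p) \<and>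
     (\<forall>c\<in>A. smooth_on (snd c ` (fst c \<inter> U)) (\<lambda>x. V (chart_inv c x) c))"

definition lie_bracket ::
  "('a, 'n::finite) chart set \<Rightarrow> ('a \<Rightarrow> ('a, 'n) tvec) \<Rightarrow> ('a \<Rightarrow> ('a, 'n) tvec) \<Rightarrow>
    'a \<Rightarrow> ('a, 'n) tvec" where
  "lie_bracket A V W p = (\<lambda>c.
     if c \<in> A \<and> p \<in> fst c
     then frechet_derivative (\<lambda>x. W (chart_inv c x) c) (at (snd c p)) (V p c)
        - frechet_derivative (\<lambda>x. V (chart_inv c x) c) (at (snd c p)) (W p c)
     else 0)"


section \<open>Riemannian metrics and the Levi-Civita connection\<close>

definition linear_form_on :: "'v::real_vector set \<Rightarrow> ('v \<Rightarrow> real) \<Rightarrow> bool" where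
  "linear_form_on E f \<longleftrightarrow>
     (\<forall>x\<in>E. \<forall>y\<in>E. f (x + y) = f x + f y) \<and> (\<forall>r. \<forall>x\<in>E. f (r *\<^sub>R x) = r * f x)"

text \<open>Only the values of a tensor on the tangent spaces are relevant. Smoothness of a tensor is
  smoothness of its values on arbitrary smooth local vector fields.\<close>

definition riemannian_metric ::
  "('a::topological_space, 'n::finite) chart set \<Rightarrow>
    ('a \<Rightarrow> ('a, 'n) tvec \<Rightarrow> ('a, 'n) tvec \<Rightarrow> real) \<Rightarrow> bool" where
  "riemannian_metric A g \<longleftrightarrow>
     (\<forall>p. let T = tangent_space A p in
        (\<forall>u\<in>T. linear_form_on T (g p u)) \<and>
        (\<forall>u\<in>T. \<forall>v\<in>T. g p u v = g p v u) \<and>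
        (\<forall>u\<in>T. u \<noteq> 0 \<longrightarrow> g p u u > 0)) \<and>
     (\<forall>U V W. open U \<and> vector_field A U V \<and> vector_field A U W \<longrightarrow>
        smooth_fun A U (\<lambda>p. g p (V p) (W p)))"

definition three_form ::
  "('a::topological_space, 'n::finite) chart set \<Rightarrow>
    ('a \<Rightarrow> ('a, 'n) tvec \<Rightarrow> ('a, 'n) tvec \<Rightarrow> ('a, 'n) tvec \<Rightarrow> real) \<Rightarrow> bool" where
  "three_form A \<phi> \<longleftrightarrow>
     (\<forall>p. let T = tangent_space A p in
        (\<forall>u\<in>T. \<forall>v\<in>T. linear_form_on T (\<phi> p u v)) \<and>
        (\<forall>u\<in>T. \<forall>v\<in>T. \<forall>w\<in>T. \<phi> p v u w = - \<phi> p u v w \<and> \<phi> p u w v = - \<phi> p u v w)) \<and>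
     (\<forall>U V1 V2 V3. open U \<and> vector_field A U V1 \<and> vector_field A U V2 \<and> vector_field A U V3 \<longrightarrow>
        smooth_fun A U (\<lambda>p. \<phi> p (V1 p) (V2 p) (V3 p)))"

text \<open>An affine connection on the tangent bundle: \<open>D p v S\<close> stands for the covariant derivative at
  \<open>p\<close>, in the direction of the tangent vector \<open>v\<close> at \<open>p\<close>, of the vector field \<open>S\<close>, which has to be
  smooth on a neighbourhood of \<open>p\<close> only.\<close>

type_synonym ('a, 'n) connection =
  "'a \<Rightarrow> ('a, 'n) tvec \<Rightarrow> ('a \<Rightarrow> ('a, 'n) tvec) \<Rightarrow> ('a, 'n) tvec"

definition affine_connection ::
  "('a::topological_space, 'n::finite) chart set \<Rightarrow> ('a, 'n) connection \<Rightarrow> bool" where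
  "affine_connection A D \<longleftrightarrow> (\<forall>U S. open U \<and> vector_field A U S \<longrightarrow>
     (\<forall>p\<in>U. \<forall>v\<in>tangent_space A p. D p v S \<in> tangent_space A p) \<and>
     (\<forall>V. vector_field A U V \<longrightarrow> vector_field A U (\<lambda>p. D p (V p) S)) \<and>
     (\<forall>p\<in>U. \<forall>v\<in>tangent_space A p. \<forall>w\<in>tangent_space A p. \<forall>r.
        D p (v + w) S = D p v S + D p w S \<and> D p (r *\<^sub>R v) S = r *\<^sub>R D p v S) \<and>
     (\<forall>R. vector_field A U R \<longrightarrow> (\<forall>p\<in>U. \<forall>v\<in>tangent_space A p.
        D p v (\<lambda>q. S q + R q) = D p v S + D p v R)) \<and>
     (\<forall>f. smooth_fun A U f \<longrightarrow> (\<forall>p\<in>U. \<forall>v\<in>tangent_space A p.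
        D p v (\<lambda>q. f q *\<^sub>R S q) = dir_deriv A p v f *\<^sub>R S p + f p *\<^sub>R D p v S)) \<and>
     (\<forall>R. (\<forall>q\<in>U. R q = S q) \<longrightarrow> (\<forall>p\<in>U. \<forall>v\<in>tangent_space A p. D p v R = D p v S)))"

definition levi_civita ::
  "('a::topological_space, 'n::finite) chart set \<Rightarrow>
    ('a \<Rightarrow> ('a, 'n) tvec \<Rightarrow> ('a, 'n) tvec \<Rightarrow> real) \<Rightarrow> ('a, 'n) connection \<Rightarrow> bool" where
  "levi_civita A g D \<longleftrightarrow> affine_connection A D \<and>
     (\<forall>U V W. open U \<and> vector_field A U V \<and> vector_field A U W \<longrightarrow>
        (\<forall>p\<in>U. D p (V p) W - D p (W p) V = lie_bracket A V W p) \<and>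
        (\<forall>p\<in>U. \<forall>v\<in>tangent_space A p.
           dir_deriv A p v (\<lambda>q. g q (V q) (W q)) = g p (D p v V) (W p) + g p (V p) (D p v W)))"

definition parallel_three_form ::
  "('a::topological_space, 'n::finite) chart set \<Rightarrow> ('a, 'n) connection \<Rightarrow>
    ('a \<Rightarrow> ('a, 'n) tvec \<Rightarrow> ('a, 'n) tvec \<Rightarrow> ('a, 'n) tvec \<Rightarrow> real) \<Rightarrow> bool" where
  "parallel_three_form A D \<phi> \<longleftrightarrow>
     (\<forall>U V1 V2 V3. open U \<and> vector_field A U V1 \<and> vector_field A U V2 \<and> vector_field A U V3 \<longrightarrow>
        (\<forall>p\<in>U. \<forall>v\<in>tangent_space A p.
           dir_deriv A p v (\<lambda>q. \<phi> q (V1 q) (V2 q) (V3 q))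
           - \<phi> p (D p v V1) (V2 p) (V3 p)
           - \<phi> p (V1 p) (D p v V2) (V3 p)
           - \<phi> p (V1 p) (V2 p) (D p v V3) = 0))"


section \<open>Holonomy contained in \<open>G\<^sub>2\<close>\<close>

text \<open>The value of \<open>\<epsilon>\<^sup>i \<and> \<epsilon>\<^sup>j \<and> \<epsilon>\<^sup>k\<close> on three vectors, in the determinant normalisation. In the
  index type \<^typ>\<open>7\<close> the numerals 1, ..., 7 are distinct (and 7 = 0).\<close>

definition eps :: "7 \<Rightarrow> 7 \<Rightarrow> 7 \<Rightarrow> real ^ 7 \<Rightarrow> real ^ 7 \<Rightarrow> real ^ 7 \<Rightarrow> real" where
  "eps i j k x y z =
     det (vector [vector [x $ i, x $ j, x $ k],
                  vector [y $ i, y $ j, y $ k],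
                  vector [z $ i, z $ j, z $ k]] :: real ^ 3 ^ 3)"

definition phi0 :: "real ^ 7 \<Rightarrow> real ^ 7 \<Rightarrow> real ^ 7 \<Rightarrow> real" where
  "phi0 x y z = eps 1 2 3 x y z
     + (eps 1 4 5 x y z - eps 1 6 7 x y z)
     + (eps 2 4 6 x y z - eps 2 7 5 x y z)
     + (eps 3 4 7 x y z - eps 3 5 6 x y z)"

definition g2_frame ::
  "('a, 7) chart set \<Rightarrow> ('a \<Rightarrow> ('a, 7) tvec \<Rightarrow> ('a, 7) tvec \<Rightarrow> ('a, 7) tvec \<Rightarrow> real) \<Rightarrow>
    'a \<Rightarrow> (7 \<Rightarrow> ('a, 7) tvec) \<Rightarrow> bool" where
  "g2_frame A \<phi> p e \<longleftrightarrow>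
     inj e \<and> independent (range e) \<and> span (range e) = tangent_space A p \<and>
     (\<forall>x y z. \<phi> p (\<Sum>i\<in>UNIV. x $ i *\<^sub>R e i) (\<Sum>i\<in>UNIV. y $ i *\<^sub>R e i) (\<Sum>i\<in>UNIV. z $ i *\<^sub>R e i)
        = phi0 x y z)"

text \<open>\<open>D\<close> is the Levi-Civita connection of \<open>g\<close>.\<close>

definition G2_manifold ::
  "('a::{t2_space, second_countable_topology}, 7) chart set \<Rightarrow>
    ('a \<Rightarrow> ('a, 7) tvec \<Rightarrow> ('a, 7) tvec \<Rightarrow> ('a, 7) tvec \<Rightarrow> real) \<Rightarrow>
    ('a \<Rightarrow> ('a, 7) tvec \<Rightarrow> ('a, 7) tvec \<Rightarrow> real) \<Rightarrow> ('a, 7) connection \<Rightarrow> bool" where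
  "G2_manifold A \<phi> g D \<longleftrightarrow>
     smooth_structure A \<and> three_form A \<phi> \<and> riemannian_metric A g \<and>
     (\<forall>p. \<exists>e. g2_frame A \<phi> p e) \<and>
     (\<forall>p e. g2_frame A \<phi> p e \<longrightarrow> (\<forall>i j. g p (e i) (e j) = (if i = j then 1 else 0))) \<and>
     levi_civita A g D \<and> parallel_three_form A D \<phi>"

definition cross ::
  "('a, 7) chart set \<Rightarrow> ('a \<Rightarrow> ('a, 7) tvec \<Rightarrow> ('a, 7) tvec \<Rightarrow> ('a, 7) tvec \<Rightarrow> real) \<Rightarrow>
    ('a \<Rightarrow> ('a, 7) tvec \<Rightarrow> ('a, 7) tvec \<Rightarrow> real) \<Rightarrow>
    'a \<Rightarrow> ('a, 7) tvec \<Rightarrow> ('a, 7) tvec \<Rightarrow> ('a, 7) tvec" where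
  "cross A \<phi> g p v w =
     (THE z. z \<in> tangent_space A p \<and> (\<forall>u\<in>tangent_space A p. g p u z = \<phi> p u v w))"

definition orth_proj :: "('v::real_vector \<Rightarrow> 'v \<Rightarrow> real) \<Rightarrow> 'v set \<Rightarrow> 'v \<Rightarrow> 'v" where
  "orth_proj h E v = (THE w. w \<in> E \<and> (\<forall>e\<in>E. h (v - w) e = 0))"


section \<open>Oriented surfaces\<close>

text \<open>\<open>\<Sigma>\<close> is an embedded surface if it is covered by charts in which it is the coordinate plane
  of the first two coordinates. Its tangent space at \<open>p\<close> is then spanned by the first two
  coordinate vectors, in any such chart.\<close>

definition slice_chart :: "('a, 7) chart set \<Rightarrow> 'a set \<Rightarrow> ('a, 7) chart \<Rightarrow> bool" where
  "slice_chart A \<Sigma> c \<longleftrightarrow> c \<in> A \<and>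
     \<Sigma> \<inter> fst c = {q \<in> fst c. \<forall>i. i \<noteq> 1 \<and> i \<noteq> 2 \<longrightarrow> snd c q $ i = 0}"

definition surface :: "('a, 7) chart set \<Rightarrow> 'a set \<Rightarrow> bool" where
  "surface A \<Sigma> \<longleftrightarrow> (\<forall>p\<in>\<Sigma>. \<exists>c. slice_chart A \<Sigma> c \<and> p \<in> fst c)"

definition surface_tangent :: "('a, 7) chart set \<Rightarrow> 'a set \<Rightarrow> 'a \<Rightarrow> ('a, 7) tvec set" where
  "surface_tangent A \<Sigma> p = {v \<in> tangent_space A p.
     \<exists>c. slice_chart A \<Sigma> c \<and> p \<in> fst c \<and> (\<forall>i. i \<noteq> 1 \<and> i \<noteq> 2 \<longrightarrow> v c $ i = 0)}"

text \<open>An orientation is given by the sets of positively oriented ordered bases of the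
  tangent spaces of the surface; locally these are the bases with the orientation of the
  coordinate frame of some slice chart.\<close>

type_synonym 'a orientation = "'a \<Rightarrow> (('a, 7) tvec \<times> ('a, 7) tvec) set"

definition orientation :: "('a, 7) chart set \<Rightarrow> 'a set \<Rightarrow> 'a orientation \<Rightarrow> bool" where
  "orientation A \<Sigma> Or \<longleftrightarrow> (\<forall>p\<in>\<Sigma>. \<exists>c. slice_chart A \<Sigma> c \<and> p \<in> fst c \<and>
     (\<forall>q\<in>\<Sigma> \<inter> fst c. Or q =
        {(u, v). u \<in> surface_tangent A \<Sigma> q \<and> v \<in> surface_tangent A \<Sigma> q \<and>
                 u c $ 1 * v c $ 2 - u c $ 2 * v c $ 1 > 0}))"

definition unit_normal ::
  "('a, 7) chart set \<Rightarrow> ('a \<Rightarrow> ('a, 7) tvec \<Rightarrow> ('a, 7) tvec \<Rightarrow> ('a, 7) tvec \<Rightarrow> real) \<Rightarrow>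
    ('a \<Rightarrow> ('a, 7) tvec \<Rightarrow> ('a, 7) tvec \<Rightarrow> real) \<Rightarrow> 'a orientation \<Rightarrow> 'a \<Rightarrow> ('a, 7) tvec" where
  "unit_normal A \<phi> g Or p = (THE n. \<forall>u v.
     (u, v) \<in> Or p \<and> g p u u = 1 \<and> g p v v = 1 \<and> g p u v = 0 \<longrightarrow> n = cross A \<phi> g p u v)"

definition W_fibre ::
  "('a, 7) chart set \<Rightarrow> ('a \<Rightarrow> ('a, 7) tvec \<Rightarrow> ('a, 7) tvec \<Rightarrow> ('a, 7) tvec \<Rightarrow> real) \<Rightarrow>
    ('a \<Rightarrow> ('a, 7) tvec \<Rightarrow> ('a, 7) tvec \<Rightarrow> real) \<Rightarrow> 'a set \<Rightarrow> 'a orientation \<Rightarrow>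
    'a \<Rightarrow> ('a, 7) tvec set" where
  "W_fibre A \<phi> g \<Sigma> Or p = {w \<in> tangent_space A p.
     (\<forall>t\<in>surface_tangent A \<Sigma> p. g p w t = 0) \<and> g p w (unit_normal A \<phi> g Or p) = 0}"

definition J_W ::
  "('a, 7) chart set \<Rightarrow> ('a \<Rightarrow> ('a, 7) tvec \<Rightarrow> ('a, 7) tvec \<Rightarrow> ('a, 7) tvec \<Rightarrow> real) \<Rightarrow>
    ('a \<Rightarrow> ('a, 7) tvec \<Rightarrow> ('a, 7) tvec \<Rightarrow> real) \<Rightarrow> 'a orientation \<Rightarrow>
    'a \<Rightarrow> ('a, 7) tvec \<Rightarrow> ('a, 7) tvec" where
  "J_W A \<phi> g Or p v = cross A \<phi> g p (unit_normal A \<phi> g Or p) v"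


section \<open>Connections along the surface\<close>

text \<open>\<open>S\<close> is an extension, smooth near \<open>p\<close>, of the section \<open>s\<close> of the restriction of the tangent
  bundle of the ambient manifold to \<open>\<Sigma> \<inter> U\<close>. A section along the surface is smooth if it has such
  an extension around each of its points.\<close>

definition extends_near ::
  "('a::topological_space, 7) chart set \<Rightarrow> 'a set \<Rightarrow> 'a \<Rightarrow>
    ('a \<Rightarrow> ('a, 7) tvec) \<Rightarrow> ('a \<Rightarrow> ('a, 7) tvec) \<Rightarrow> bool" where
  "extends_near A \<Sigma> p s S \<longleftrightarrow>
     (\<exists>U. open U \<and> p \<in> U \<and> vector_field A U S \<and> (\<forall>q\<in>\<Sigma> \<inter> U. S q = s q))"

text \<open>Smooth sections over \<open>\<Sigma> \<inter> U\<close> of the bundle along \<open>\<Sigma>\<close> with fibres \<open>E q\<close>.\<close>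

definition section_along ::
  "('a::topological_space, 7) chart set \<Rightarrow> 'a set \<Rightarrow> ('a \<Rightarrow> ('a, 7) tvec set) \<Rightarrow> 'a set \<Rightarrow>
    ('a \<Rightarrow> ('a, 7) tvec) \<Rightarrow> bool" where
  "section_along A \<Sigma> E U s \<longleftrightarrow>
     (\<forall>q\<in>\<Sigma> \<inter> U. s q \<in> E q) \<and> (\<forall>p\<in>\<Sigma> \<inter> U. \<exists>S. extends_near A \<Sigma> p s S)"

text \<open>The restriction to \<open>\<Sigma>\<close> of the ambient connection. For \<open>v\<close> tangent to \<open>\<Sigma>\<close> the result
  does not depend on the chosen extension.\<close>

definition nabla_X ::
  "('a::topological_space, 7) chart set \<Rightarrow> ('a, 7) connection \<Rightarrow> 'a set \<Rightarrow> ('a, 7) connection" where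
  "nabla_X A D \<Sigma> p v s = D p v (SOME S. extends_near A \<Sigma> p s S)"

definition nabla_W ::
  "('a::topological_space, 7) chart set \<Rightarrow>
    ('a \<Rightarrow> ('a, 7) tvec \<Rightarrow> ('a, 7) tvec \<Rightarrow> ('a, 7) tvec \<Rightarrow> real) \<Rightarrow>
    ('a \<Rightarrow> ('a, 7) tvec \<Rightarrow> ('a, 7) tvec \<Rightarrow> real) \<Rightarrow> ('a, 7) connection \<Rightarrow>
    'a set \<Rightarrow> 'a orientation \<Rightarrow> ('a, 7) connection" where
  "nabla_W A \<phi> g D \<Sigma> Or p v s =
     orth_proj (g p) (W_fibre A \<phi> g \<Sigma> Or p) (nabla_X A D \<Sigma> p v s)"

text \<open>\<open>\<nabla>\<^sup>W \<J> = 0\<close>: the derivative \<open>(\<nabla>\<^sup>W\<^sub>v \<J>) s = \<nabla>\<^sup>W\<^sub>v (\<J> s) - \<J> (\<nabla>\<^sup>W\<^sub>v s)\<close> vanishes for all local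
  sections \<open>s\<close> of \<open>W\<close>.\<close>

definition nabla_W_hermitian ::
  "('a::topological_space, 7) chart set \<Rightarrow>
    ('a \<Rightarrow> ('a, 7) tvec \<Rightarrow> ('a, 7) tvec \<Rightarrow> ('a, 7) tvec \<Rightarrow> real) \<Rightarrow>
    ('a \<Rightarrow> ('a, 7) tvec \<Rightarrow> ('a, 7) tvec \<Rightarrow> real) \<Rightarrow> ('a, 7) connection \<Rightarrow>
    'a set \<Rightarrow> 'a orientation \<Rightarrow> bool" where
  "nabla_W_hermitian A \<phi> g D \<Sigma> Or \<longleftrightarrow>
     (\<forall>U s. open U \<and> section_along A \<Sigma> (W_fibre A \<phi> g \<Sigma> Or) U s \<longrightarrow>
        (\<forall>p\<in>\<Sigma> \<inter> U. \<forall>v\<in>surface_tangent A \<Sigma> p.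
           nabla_W A \<phi> g D \<Sigma> Or p v (\<lambda>q. J_W A \<phi> g Or q (s q))
           - J_W A \<phi> g Or p (nabla_W A \<phi> g D \<Sigma> Or p v s) = 0))"

text \<open>\<open>B(v, w)\<close> is the normal component of the derivative along \<open>v\<close> of a local vector field on
  the surface with value \<open>w\<close> at \<open>p\<close>; it does not depend on the choice of this field.\<close>

definition second_fundamental_form ::
  "('a::topological_space, 7) chart set \<Rightarrow>
    ('a \<Rightarrow> ('a, 7) tvec \<Rightarrow> ('a, 7) tvec \<Rightarrow> real) \<Rightarrow> ('a, 7) connection \<Rightarrow> 'a set \<Rightarrow>
    'a \<Rightarrow> ('a, 7) tvec \<Rightarrow> ('a, 7) tvec \<Rightarrow> ('a, 7) tvec" where
  "second_fundamental_form A g D \<Sigma> p v w =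
     (let Y = (SOME Y. Y p = w \<and>
                 (\<exists>U. open U \<and> p \<in> U \<and> section_along A \<Sigma> (surface_tangent A \<Sigma>) U Y));
          z = nabla_X A D \<Sigma> p v Y
      in z - orth_proj (g p) (surface_tangent A \<Sigma> p) z)"

end

theory Submission
  imports Defs
begin

text \<open>
  Write \<open>\<eta>\<close> for the unit normal field and \<open>N\<close> for a smooth local extension of it. Both sides of the
  equivalence say that \<open>D\<^sub>v N\<close> is orthogonal to the surface, for every tangent direction \<open>v\<close>.

  For the second fundamental form: if \<open>Y\<close> is a tangent field of the surface, then \<open>g(Y, \<eta>) = 0\<close>, so
  differentiating along \<open>v\<close> gives \<open>g(D\<^sub>v Y, \<eta>) = - g(Y, D\<^sub>v N)\<close>, and the left-hand side is the
  component of the normal vector \<open>B(v, Y)\<close> along \<open>\<eta>\<close>, the only normal direction outside \<open>W\<close>.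

  For the connection: let \<open>s\<close> be a section of \<open>W\<close> and \<open>t\<close> a vector in \<open>W\<close>. Since \<open>g(\<J> s, t) = \<phi>(\<eta>, s, t)\<close>
  and both \<open>g\<close> and \<open>\<phi>\<close> are parallel, the product rule leaves
  \<open>g((\<nabla>\<^sup>W\<^sub>v \<J>) s, t) = \<phi>(D\<^sub>v N, s, t)\<close>; projecting \<open>D\<^sub>v s\<close> to \<open>W\<close> costs nothing, because \<open>\<eta> \<times> \<close> maps the
  span of the tangent plane and \<open>\<eta>\<close> to itself (lemma \<open>nabla_W_J_pairing\<close>). As \<open>\<eta>\<close> has unit length,
  \<open>D\<^sub>v N\<close> is orthogonal to \<open>\<eta>\<close>. So it remains to see for which \<open>x\<close> orthogonal to \<open>\<eta>\<close> the form
  \<open>\<phi>(x, \<cdot>, \<cdot>)\<close> vanishes on \<open>W\<close>. It does for \<open>x \<in> W\<close>, as \<open>W\<close> is the orthogonal complement of an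
  associative 3-plane, and for a tangent vector \<open>x\<close> and \<open>s \<in> W\<close> it satisfies
  \<open>\<phi>(x, s, x \<times> s) = \<bar>x\<bar>\<^sup>2 \<bar>s\<bar>\<^sup>2\<close> with \<open>x \<times> s \<in> W\<close>, so it vanishes exactly if the tangential part of \<open>x\<close> does
  (lemma \<open>phi0_W0_iff\<close>).

  The pointwise algebra takes place in the model \<open>\<real>\<^sup>7\<close>, where it reduces to the single identity
  \<open>x \<times> (x \<times> y) = (x \<bullet> y) x - \<bar>x\<bar>\<^sup>2 y\<close>, and is carried to the tangent spaces by the isometries that
  \<open>G\<^sub>2\<close>-frames provide. The analytic part supplies the smooth extensions that the argument
  differentiates: a Gram-Schmidt frame adapted to the surface makes \<open>\<eta>\<close>, cross products of vector
  fields and projections to \<open>W\<close> smooth. That the derivative of a section along the surface does not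
  depend on the extension follows from metric compatibility alone (lemma \<open>D_extension_unique\<close>).
\<close>

section \<open>Closure properties of smooth maps\<close>

lemma frechet_derivative_cong_open:
  assumes "open S" "x \<in> S" "\<And>y. y \<in> S \<Longrightarrow> f y = h y"
  shows "frechet_derivative f (at x) = frechet_derivative h (at x)"
proof -
  have "(f has_derivative L) (at x) \<longleftrightarrow> (h has_derivative L) (at x)" for L
    using assms has_derivative_transform_within_open[of f L x UNIV S h]
      has_derivative_transform_within_open[of h L x UNIV S f] by auto
  then show ?thesis by (simp add: frechet_derivative_def)
qed

lemma differentiable_cong_open:
  assumes "open S" "x \<in> S" "\<And>y. y \<in> S \<Longrightarrow> f y = h y" "f differentiable (at x)"
  shows "h differentiable (at x)"
  using assms has_derivative_transform_within_open[of f _ x UNIV S h]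
  unfolding differentiable_def by blast

lemma frechet_derivative_eqI: "(f has_derivative L) (at x) \<Longrightarrow> frechet_derivative f (at x) = L"
  by (metis frechet_derivative_at)

lemma has_frechet: "f differentiable (at x) \<Longrightarrow> (f has_derivative frechet_derivative f (at x)) (at x)"
  by (simp add: frechet_derivative_works)

lemma Ck_on_cong:
  assumes "open S" "\<And>x. x \<in> S \<Longrightarrow> f x = h x" "Ck_on n S f"
  shows "Ck_on n S h"
  using assms(2,3)
proof (induction n arbitrary: f h)
  case 0
  then show ?case using continuous_on_cong[of S S f h] by simp
next
  case (Suc n)
  have "frechet_derivative f (at x) = frechet_derivative h (at x)" if "x \<in> S" for x
    using frechet_derivative_cong_open[OF \<open>open S\<close> that] Suc.prems(1) by blast
  then have "Ck_on n S (\<lambda>x. frechet_derivative h (at x) v)" for v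
    using Suc.prems(2) Suc.IH[of "\<lambda>x. frechet_derivative f (at x) v" "\<lambda>x. frechet_derivative h (at x) v"]
    by simp
  moreover have "h differentiable (at x)" if "x \<in> S" for x
    using differentiable_cong_open[OF \<open>open S\<close> that] Suc.prems that by auto
  ultimately show ?case by simp
qed

lemma Ck_on_subset: "Ck_on n S f \<Longrightarrow> S' \<subseteq> S \<Longrightarrow> Ck_on n S' f"
  by (induction n arbitrary: f) (auto intro: continuous_on_subset)

lemma Ck_on_Suc_imp: "Ck_on (Suc n) S f \<Longrightarrow> Ck_on n S f"
proof (induction n arbitrary: f)
  case 0
  then show ?case
    by (auto intro!: continuous_at_imp_continuous_on differentiable_imp_continuous_within)
next
  case (Suc n)
  show ?case
    using Suc.prems Suc.IH unfolding Ck_on.simps(2)[of "Suc n"] Ck_on.simps(2)[of n S f] by blast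
qed

lemma Ck_on_const: "Ck_on n S (\<lambda>x. k)"
  by (induction n arbitrary: k) auto

text \<open>\<open>Ck_on\<close> refers to the chosen derivative of the function. With this rule the closure properties
  below need only exhibit some derivative, by an induction on the order.\<close>

lemma Ck_on_SucI:
  assumes "open S" "\<And>x. x \<in> S \<Longrightarrow> (f has_derivative L x) (at x)" "\<And>v. Ck_on n S (\<lambda>x. L x v)"
  shows "Ck_on (Suc n) S f"
proof -
  have "Ck_on n S (\<lambda>x. frechet_derivative f (at x) v)" for v
    by (rule Ck_on_cong[OF assms(1) _ assms(3)[of v]])
      (use frechet_derivative_eqI[OF assms(2)] in auto)
  then show ?thesis using assms(2) by (auto simp: differentiable_def)
qed

lemma Ck_on_SucD:
  assumes "Ck_on (Suc n) S f"
  shows "x \<in> S \<Longrightarrow> (f has_derivative frechet_derivative f (at x)) (at x)"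
    and "Ck_on n S (\<lambda>x. frechet_derivative f (at x) v)"
  using assms has_frechet by auto

lemma Ck_on_linear:
  assumes "open S" "bounded_linear h" "Ck_on n S f"
  shows "Ck_on n S (\<lambda>x. h (f x))"
  using assms(3)
proof (induction n arbitrary: f)
  case 0
  then show ?case
    using linear_continuous_on[OF assms(2)] continuous_on_compose2[of UNIV h S f] by simp
next
  case (Suc n)
  note d = Ck_on_SucD[OF Suc.prems]
  show ?case
    by (rule Ck_on_SucI[OF assms(1) bounded_linear.has_derivative[OF assms(2) d(1)] Suc.IH[OF d(2)]])
qed

lemma Ck_on_add:
  assumes "open S" "Ck_on n S f" "Ck_on n S h"
  shows "Ck_on n S (\<lambda>x. f x + h x)"
  using assms(2,3)
proof (induction n arbitrary: f h)
  case 0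
  then show ?case by (simp add: continuous_on_add)
next
  case (Suc n)
  note d = Ck_on_SucD[OF Suc.prems(1)] Ck_on_SucD[OF Suc.prems(2)]
  show ?case
    by (rule Ck_on_SucI[OF assms(1) has_derivative_add[OF d(1) d(3)] Suc.IH[OF d(2) d(4)]])
qed

lemma Ck_on_scaleR:
  fixes f :: "'a::real_normed_vector \<Rightarrow> real"
  assumes "open S" "Ck_on n S f" "Ck_on n S h"
  shows "Ck_on n S (\<lambda>x. f x *\<^sub>R h x)"
  using assms(2,3)
proof (induction n arbitrary: f h)
  case 0
  then show ?case by (simp add: continuous_on_scaleR)
next
  case (Suc n)
  note d = Ck_on_SucD[OF Suc.prems(1)] Ck_on_SucD[OF Suc.prems(2)]
  note i = Suc.prems[THEN Ck_on_Suc_imp]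
  show ?case
    by (rule Ck_on_SucI[OF assms(1) has_derivative_scaleR[OF d(1) d(3)]], assumption, assumption)
      (rule Ck_on_add[OF assms(1) Suc.IH[OF i(1) d(4)] Suc.IH[OF d(2) i(2)]])
qed

lemma Ck_on_sum:
  assumes "open S" "finite I" "\<And>i. i \<in> I \<Longrightarrow> Ck_on n S (f i)"
  shows "Ck_on n S (\<lambda>x. \<Sum>i\<in>I. f i x)"
  using assms(2,3)
  by (induction I rule: finite_induct) (auto simp: Ck_on_const intro: Ck_on_add[OF assms(1)])

text \<open>The chain rule expresses the derivative of the composition as a sum of products of coordinates of
  \<open>f'\<close> with partial derivatives \<open>h' \<circ> f\<close>, to which the induction hypothesis applies. Expanding in a
  basis is what makes the directions fed to \<open>h'\<close> constant.\<close>

lemma Ck_on_compose: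
  fixes f :: "'a::real_normed_vector \<Rightarrow> 'b::euclidean_space"
  assumes "open S" "Ck_on n S f" "Ck_on n R h" "f ` S \<subseteq> R"
  shows "Ck_on n S (\<lambda>x. h (f x))"
  using assms(2,3,4)
proof (induction n arbitrary: h)
  case 0
  then show ?case using continuous_on_compose2[of R h S f] by auto
next
  case (Suc n)
  note d = Ck_on_SucD[OF Suc.prems(1)] Ck_on_SucD[OF Suc.prems(2)]
  have "((\<lambda>y. h (f y)) has_derivative (\<lambda>v. \<Sum>b\<in>Basis. (frechet_derivative f (at x) v \<bullet> b) *\<^sub>R
       frechet_derivative h (at (f x)) b)) (at x)" if "x \<in> S" for x
  proof -
    have h: "(h has_derivative frechet_derivative h (at (f x))) (at (f x))"
      using d(3) Suc.prems(3) that by blast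
    have lin: "frechet_derivative h (at (f x)) w = (\<Sum>b\<in>Basis. (w \<bullet> b) *\<^sub>R frechet_derivative h (at (f x)) b)" for w
    proof -
      interpret linear "frechet_derivative h (at (f x))"
        using h has_derivative_linear by blast
      have "frechet_derivative h (at (f x)) w = frechet_derivative h (at (f x)) (\<Sum>b\<in>Basis. (w \<bullet> b) *\<^sub>R b)"
        by (simp add: euclidean_representation)
      then show ?thesis by (simp add: sum scaleR)
    qed
    show ?thesis
      using has_derivative_compose[OF d(1)[OF that] h] unfolding lin[of "frechet_derivative f (at x) _"] .
  qed
  then show ?case
  proof (rule Ck_on_SucI[OF assms(1)])
    fix v
    have "Ck_on n S (\<lambda>x. frechet_derivative f (at x) v \<bullet> b)" for b
      by (rule Ck_on_linear[OF assms(1) bounded_linear_inner_left d(2)])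
    moreover have "Ck_on n S (\<lambda>x. frechet_derivative h (at (f x)) b)" for b
      by (rule Suc.IH[OF Ck_on_Suc_imp[OF Suc.prems(1)] d(4) Suc.prems(3)])
    ultimately show "Ck_on n S (\<lambda>x. \<Sum>b\<in>Basis. (frechet_derivative f (at x) v \<bullet> b) *\<^sub>R
       frechet_derivative h (at (f x)) b)"
      by (intro Ck_on_sum[OF assms(1)] finite_Basis Ck_on_scaleR[OF assms(1)])
  qed
qed

text \<open>The exponent is arbitrary because the derivative lowers it by one. The case needed later is the
  normalising factor of exponent \<open>-1/2\<close> in the Gram-Schmidt process.\<close>

lemma Ck_on_powr:
  fixes f :: "'a::real_normed_vector \<Rightarrow> real"
  assumes "open S" "Ck_on n S f" "\<And>x. x \<in> S \<Longrightarrow> f x > 0"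
  shows "Ck_on n S (\<lambda>x. f x powr a)"
  using assms(2)
proof (induction n arbitrary: a)
  case 0
  then show ?case
    using assms(3) by (auto intro!: continuous_on_powr continuous_on_const simp: less_imp_neq[THEN not_sym])
next
  case (Suc n)
  note d = Ck_on_SucD[OF Suc.prems]
  have "((\<lambda>x. f x powr a) has_derivative
      (\<lambda>v. (a * f x powr (a - 1)) *\<^sub>R frechet_derivative f (at x) v)) (at x)" if "x \<in> S" for x
  proof -
    have "((\<lambda>y. y powr a) has_real_derivative a * f x powr (a - 1)) (at (f x))"
      using assms(3)[OF that] by (rule has_real_derivative_powr)
    then have "((\<lambda>y. y powr a) has_derivative (*) (a * f x powr (a - 1))) (at (f x))"
      by (simp add: has_field_derivative_def)
    from has_derivative_compose[OF d(1)[OF that] this] show ?thesis by simp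
  qed
  then show ?case
  proof (rule Ck_on_SucI[OF assms(1)])
    fix v
    have "Ck_on n S (\<lambda>x. a * f x powr (a - 1))"
      by (rule Ck_on_linear[OF assms(1) bounded_linear_mult_right Suc.IH[OF Ck_on_Suc_imp[OF Suc.prems]]])
    then show "Ck_on n S (\<lambda>x. (a * f x powr (a - 1)) *\<^sub>R frechet_derivative f (at x) v)"
      by (rule Ck_on_scaleR[OF assms(1) _ d(2)])
  qed
qed

lemma smooth_on_cong: "open S \<Longrightarrow> (\<And>x. x \<in> S \<Longrightarrow> f x = h x) \<Longrightarrow> smooth_on S f \<Longrightarrow> smooth_on S h"
  unfolding smooth_on_def using Ck_on_cong by blast

lemma smooth_on_subset: "smooth_on S f \<Longrightarrow> S' \<subseteq> S \<Longrightarrow> smooth_on S' f"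
  unfolding smooth_on_def using Ck_on_subset by blast

lemma smooth_on_differentiable: "smooth_on S f \<Longrightarrow> x \<in> S \<Longrightarrow> f differentiable (at x)"
  unfolding smooth_on_def by (metis Ck_on.simps(2))

lemma smooth_on_frechet: "smooth_on S f \<Longrightarrow> smooth_on S (\<lambda>x. frechet_derivative f (at x) v)"
  unfolding smooth_on_def by (metis Ck_on.simps(2))

lemma smooth_on_const: "smooth_on S (\<lambda>x. k)"
  unfolding smooth_on_def using Ck_on_const by blast

lemma smooth_on_add:
  "open S \<Longrightarrow> smooth_on S f \<Longrightarrow> smooth_on S h \<Longrightarrow> smooth_on S (\<lambda>x. f x + h x)"
  unfolding smooth_on_def using Ck_on_add by blast

lemma smooth_on_scaleR:
  fixes f :: "'a::real_normed_vector \<Rightarrow> real"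
  shows "open S \<Longrightarrow> smooth_on S f \<Longrightarrow> smooth_on S h \<Longrightarrow> smooth_on S (\<lambda>x. f x *\<^sub>R h x)"
  unfolding smooth_on_def using Ck_on_scaleR by blast

lemma smooth_on_compose:
  fixes f :: "'a::real_normed_vector \<Rightarrow> 'b::euclidean_space"
  shows "open S \<Longrightarrow> smooth_on S f \<Longrightarrow> smooth_on R h \<Longrightarrow> f ` S \<subseteq> R \<Longrightarrow> smooth_on S (\<lambda>x. h (f x))"
  unfolding smooth_on_def using Ck_on_compose by blast

lemma smooth_on_powr:
  fixes f :: "'a::real_normed_vector \<Rightarrow> real"
  shows "open S \<Longrightarrow> smooth_on S f \<Longrightarrow> (\<And>x. x \<in> S \<Longrightarrow> f x > 0) \<Longrightarrow> smooth_on S (\<lambda>x. f x powr a)"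
  unfolding smooth_on_def using Ck_on_powr by blast

section \<open>The cross product of the model three-form\<close>

lemma exhaust_7: fixes x :: 7 shows "x = 1 \<or> x = 2 \<or> x = 3 \<or> x = 4 \<or> x = 5 \<or> x = 6 \<or> x = 7"
proof (induct x)
  case (of_int z)
  then have "0 \<le> z" and "z < 7" by simp_all
  then have "z = 0 \<or> z = 1 \<or> z = 2 \<or> z = 3 \<or> z = 4 \<or> z = 5 \<or> z = 6" by arith
  then show ?case by auto
qed

lemma UNIV_7: "UNIV = {1, 2, 3, 4, 5, 6, 7 :: 7}"
  using exhaust_7 by auto

lemma forall_7: "(\<forall>i::7. P i) \<longleftrightarrow> P 1 \<and> P 2 \<and> P 3 \<and> P 4 \<and> P 5 \<and> P 6 \<and> P 7"
  by (metis exhaust_7)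

lemma sum_7: "(\<Sum>i\<in>UNIV. f i) = f 1 + f 2 + f 3 + f 4 + f 5 + f 6 + f (7::7)"
  unfolding UNIV_7 by (simp add: add.assoc)

definition cross0 :: "real ^ 7 \<Rightarrow> real ^ 7 \<Rightarrow> real ^ 7" where
  "cross0 x y = (\<chi> i. phi0 (axis i 1) x y)"

lemma det_vector_3: "det (vector [vector [a, b, c], vector [d, e, f], vector [h, i, j]] :: real ^ 3 ^ 3)
   = a * (e * j - f * i) - b * (d * j - f * h) + c * (d * i - e * h)"
  by (simp add: det_3 vector_3 algebra_simps)

lemmas phi0_expand = phi0_def eps_def det_vector_3

lemma phi0_linear:
  "linear (\<lambda>x. phi0 x y z)" "linear (\<lambda>y. phi0 x y z)" "linear (\<lambda>z. phi0 x y z)"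
  by (auto intro!: linearI simp: phi0_expand algebra_simps)

lemma phi0_swap: "phi0 y x z = - phi0 x y z" "phi0 x z y = - phi0 x y z"
  by (simp_all add: phi0_expand algebra_simps)

lemma inner_cross0: "u \<bullet> cross0 x y = phi0 u x y"
proof -
  interpret linear "\<lambda>u. phi0 u x y" by (rule phi0_linear)
  have "phi0 u x y = phi0 (\<Sum>i\<in>UNIV. u $ i *\<^sub>R axis i 1) x y"
    by (simp add: basis_expansion scalar_mult_eq_scaleR[symmetric])
  also have "\<dots> = (\<Sum>i\<in>UNIV. u $ i * phi0 (axis i 1) x y)"
    by (simp add: sum scale)
  finally show ?thesis by (simp add: cross0_def inner_vec_def)
qed

lemma cross0_components:
  "cross0 x y $ 1 = x$2*y$3 - x$3*y$2 + x$4*y$5 - x$5*y$4 - (x$6*y$7 - x$7*y$6)"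
  "cross0 x y $ 2 = x$3*y$1 - x$1*y$3 + x$4*y$6 - x$6*y$4 - (x$7*y$5 - x$5*y$7)"
  "cross0 x y $ 3 = x$1*y$2 - x$2*y$1 + x$4*y$7 - x$7*y$4 - (x$5*y$6 - x$6*y$5)"
  "cross0 x y $ 4 = x$5*y$1 - x$1*y$5 + x$6*y$2 - x$2*y$6 + x$7*y$3 - x$3*y$7"
  "cross0 x y $ 5 = x$1*y$4 - x$4*y$1 - (x$2*y$7 - x$7*y$2) - (x$6*y$3 - x$3*y$6)"
  "cross0 x y $ 6 = x$2*y$4 - x$4*y$2 - (x$7*y$1 - x$1*y$7) - (x$3*y$5 - x$5*y$3)"
  "cross0 x y $ 7 = x$3*y$4 - x$4*y$3 - (x$1*y$6 - x$6*y$1) - (x$5*y$2 - x$2*y$5)"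
  by (simp_all add: cross0_def phi0_expand axis_def algebra_simps)

text \<open>The only property of the coefficients of \<open>phi0\<close> that is used: all later identities for the cross
  product follow from it. It is a polynomial identity in the coordinates.\<close>

lemma cross0_cross0: "cross0 x (cross0 x y) = (x \<bullet> y) *\<^sub>R x - (x \<bullet> x) *\<^sub>R y"
proof -
  have "\<forall>i. cross0 x (cross0 x y) $ i = ((x \<bullet> y) *\<^sub>R x - (x \<bullet> x) *\<^sub>R y) $ i"
    unfolding forall_7 vector_minus_component vector_scaleR_component inner_vec_def inner_real_def
      sum_7 cross0_components real_scaleR_def
    by (intro conjI; simp add: algebra_simps)
  then show ?thesis by (simp add: vec_eq_iff)
qed

lemma linear_cross0: "linear (cross0 x)" "linear (\<lambda>x. cross0 x y)"
  unfolding cross0_def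
  by (auto intro!: linearI simp: vec_eq_iff linear_add[OF phi0_linear(2)] linear_add[OF phi0_linear(3)]
     linear_scale[OF phi0_linear(2)] linear_scale[OF phi0_linear(3)])

lemmas cross0_simps = linear_add[OF linear_cross0(1)] linear_diff[OF linear_cross0(1)]
  linear_neg[OF linear_cross0(1)] linear_scale[OF linear_cross0(1)] linear_0[OF linear_cross0(1)]
  linear_add[OF linear_cross0(2)] linear_diff[OF linear_cross0(2)]
  linear_neg[OF linear_cross0(2)] linear_scale[OF linear_cross0(2)] linear_0[OF linear_cross0(2)]

lemmas phi0_simps = linear_add[OF phi0_linear(1)] linear_diff[OF phi0_linear(1)]
  linear_neg[OF phi0_linear(1)] linear_scale[OF phi0_linear(1)] linear_0[OF phi0_linear(1)]

lemma cross0_swap: "cross0 y x = - cross0 x y"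
  by (simp add: vec_eq_iff cross0_def phi0_swap(2)[of _ x y])

lemma phi0_rotate: "phi0 x y z = phi0 y z x"
  using phi0_swap(1)[of y x z] phi0_swap(2)[of y x z] by simp

lemma phi0_repeat: "phi0 x x y = 0" "phi0 y x x = 0" "phi0 x y x = 0"
  using phi0_swap(1)[of x x y] phi0_swap(2)[of y x x] phi0_rotate[of x y x] by auto

text \<open>The polarisation of \<open>cross0_cross0\<close> in \<open>x\<close>.\<close>

lemma cross0_polar:
  "cross0 x (cross0 z y) + cross0 z (cross0 x y) = (x \<bullet> y) *\<^sub>R z + (z \<bullet> y) *\<^sub>R x - (2 * (x \<bullet> z)) *\<^sub>R y"
proof -
  have "cross0 (x + z) (cross0 (x + z) y) = ((x + z) \<bullet> y) *\<^sub>R (x + z) - ((x + z) \<bullet> (x + z)) *\<^sub>R y"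
    by (rule cross0_cross0)
  then show ?thesis
    using cross0_cross0[of x y] cross0_cross0[of z y]
    by (simp add: cross0_simps inner_left_distrib inner_right_distrib inner_commute[of z x] scaleR_left_distrib
      scaleR_right_distrib) (simp add: algebra_simps)
qed

text \<open>On mutually orthogonal vectors the right-hand side vanishes: there the product is anti-associative.\<close>

lemma cross0_assoc:
  "cross0 x (cross0 y z) + cross0 (cross0 x y) z = (2 * (x \<bullet> z)) *\<^sub>R y - (x \<bullet> y) *\<^sub>R z - (y \<bullet> z) *\<^sub>R x"
  using cross0_polar[of z x y] cross0_swap[of "cross0 x y" z] cross0_swap[of y z]
  by (simp add: cross0_simps inner_commute algebra_simps)

text \<open>The operator \<open>a \<times> \<close> is skew, and anti-associative up to terms that vanish when paired with \<open>r\<close>; the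
  two signs cancel when it moves to another argument of \<open>phi0\<close>.\<close>

lemma phi0_shift:
  assumes "a \<bullet> s = 0" "a \<bullet> t = 0" "a \<bullet> r = 0"
  shows "phi0 (cross0 a s) t r = phi0 s t (cross0 a r)"
proof -
  have "r \<bullet> (cross0 a (cross0 s t) + cross0 (cross0 a s) t) = 0"
    using assms by (simp add: cross0_assoc inner_diff_right inner_commute)
  then have "phi0 r a (cross0 s t) + phi0 r (cross0 a s) t = 0"
    by (simp add: inner_right_distrib inner_cross0)
  moreover have "phi0 r a (cross0 s t) = - phi0 (cross0 a r) s t"
    using inner_cross0[of "cross0 s t" r a] phi0_rotate[of "cross0 s t" r a] cross0_swap[of r a]
      inner_cross0[of "cross0 a r" s t] by (simp add: inner_commute)
  ultimately show ?thesis
    using phi0_rotate[of "cross0 a r" s t] phi0_rotate[of r "cross0 a s" t] by simp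
qed

lemma phi0_shift':
  assumes "a \<bullet> s = 0" "a \<bullet> t = 0" "a \<bullet> r = 0"
  shows "phi0 s (cross0 a t) r = phi0 s t (cross0 a r)"
  using phi0_shift[of a t s r] assms phi0_swap(1)[of s "cross0 a t" r] phi0_swap(1)[of t s "cross0 a r"]
  by simp

text \<open>The model situation at a point of the surface: \<open>u, v\<close> is an oriented orthonormal basis of the
  tangent plane, \<open>n\<close> is the unit normal, and \<open>W0\<close> is the fibre of \<open>W\<close>.\<close>

locale orthonormal_pair =
  fixes u v :: "real ^ 7"
  assumes uv: "u \<bullet> u = 1" "v \<bullet> v = 1" "u \<bullet> v = 0"
begin

abbreviation "n \<equiv> cross0 u v"

definition "W0 = {w. w \<bullet> u = 0 \<and> w \<bullet> v = 0 \<and> w \<bullet> n = 0}"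

lemma cross_n: "cross0 n u = v" "cross0 n v = - u" "cross0 u n = - v" "cross0 v n = u"
proof -
  show un: "cross0 u n = - v" using uv by (simp add: cross0_cross0)
  then show "cross0 n u = v" using cross0_swap[of n u] by simp
  show vn: "cross0 v n = u"
    using uv cross0_cross0[of v u] by (simp add: cross0_swap[of u v] cross0_simps inner_commute)
  then show "cross0 n v = - u" using cross0_swap[of n v] by simp
qed

lemma n_orth: "u \<bullet> n = 0" "v \<bullet> n = 0" "n \<bullet> n = 1"
proof -
  show "u \<bullet> n = 0" "v \<bullet> n = 0" by (simp_all add: inner_cross0 phi0_repeat)
  have "n \<bullet> n = v \<bullet> cross0 n u" using phi0_rotate[of v n u] by (simp only: inner_cross0)
  then show "n \<bullet> n = 1" using uv by (simp add: cross_n)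
qed

lemma W0_cross:
  assumes "w \<in> W0"
  shows "cross0 u w \<in> W0" "cross0 v w \<in> W0" "cross0 n w \<in> W0"
proof -
  have "cross0 y w \<bullet> x = w \<bullet> cross0 x y" for x y
    using phi0_rotate[of w x y] by (simp add: inner_cross0 inner_commute[of "cross0 y w"])
  moreover have "cross0 v u = - n" "cross0 x x = 0" for x
    using cross0_swap[of v u] by (simp_all add: cross0_def phi0_repeat vec_eq_iff)
  moreover have "w \<bullet> u = 0" "w \<bullet> v = 0" "w \<bullet> n = 0" using assms by (auto simp: W0_def)
  ultimately show "cross0 u w \<in> W0" "cross0 v w \<in> W0" "cross0 n w \<in> W0"
    unfolding W0_def by (simp_all add: cross_n)
qed

lemma W0_subspace:
  "x \<in> W0 \<Longrightarrow> y \<in> W0 \<Longrightarrow> x + y \<in> W0" "x \<in> W0 \<Longrightarrow> y \<in> W0 \<Longrightarrow> x - y \<in> W0" "x \<in> W0 \<Longrightarrow> r *\<^sub>R x \<in> W0"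
  by (auto simp: W0_def inner_left_distrib inner_diff_left)

text \<open>The operators \<open>u \<times> \<close> and \<open>v \<times> \<close> anticommute on \<open>W0\<close> and have square \<open>-1\<close> there. Since both can be
  moved freely between the arguments of \<open>phi0\<close>, they commute inside \<open>phi0\<close>, so \<open>phi0\<close> vanishes as
  soon as its first argument is in the image of their composition, which is all of \<open>W0\<close>.\<close>

lemma phi0_W0_eq_0:
  assumes "s \<in> W0" "t \<in> W0" "r \<in> W0"
  shows "phi0 s t r = 0"
proof -
  have perp: "u \<bullet> x = 0" "v \<bullet> x = 0" if "x \<in> W0" for x
    using that by (auto simp: W0_def inner_commute)
  \<comment> \<open>exchanging the two operators shows that the value is its own negative\<close>
  have *: "phi0 (cross0 u (cross0 v x)) t r = 0" if x: "x \<in> W0" for x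
  proof -
    note m = W0_cross(1,2)[OF x] W0_cross(1,2)[OF assms(2)] W0_cross(1,2)[OF assms(3)] x assms(2,3)
    note p = m[THEN perp(1)] m[THEN perp(2)]
    have "phi0 (cross0 u (cross0 v x)) t r = phi0 (cross0 v x) (cross0 u t) r"
      using phi0_shift[of u "cross0 v x" t r] phi0_shift'[of u "cross0 v x" t r] p by simp
    also have "\<dots> = phi0 x (cross0 u t) (cross0 v r)"
      using phi0_shift p by simp
    also have "\<dots> = phi0 (cross0 u x) t (cross0 v r)"
      using phi0_shift[of u x t "cross0 v r"] phi0_shift'[of u x t "cross0 v r"] p by simp
    also have "\<dots> = phi0 (cross0 v (cross0 u x)) t r"
      using phi0_shift p by simp
    also have "cross0 v (cross0 u x) = - cross0 u (cross0 v x)"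
      using cross0_polar[of u v x] p uv by (simp add: eq_neg_iff_add_eq_0 add.commute)
    finally show ?thesis by (simp add: phi0_simps)
  qed
  have "cross0 u (cross0 v (cross0 v (cross0 u s))) = s"
    using cross0_cross0[of v "cross0 u s"] cross0_cross0[of u s] uv
      perp[OF assms(1)] perp[OF W0_cross(1)[OF assms(1)]]
    by (simp add: cross0_simps)
  with *[OF W0_cross(2)[OF W0_cross(1)[OF assms(1)]]] show ?thesis by simp
qed

text \<open>By the preceding lemma only the tangential part \<open>y\<close> of \<open>x\<close> contributes. If \<open>y \<noteq> 0\<close>, any nonzero
  \<open>s \<in> W0\<close> gives a vector \<open>y \<times> s \<in> W0\<close> with \<open>phi0 y s (y \<times> s) = \<bar>y\<bar>\<^sup>2 \<bar>s\<bar>\<^sup>2\<close>; such an \<open>s\<close>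
  exists because three vectors do not span \<open>\<real>\<^sup>7\<close>.\<close>

lemma phi0_W0_iff:
  assumes "x \<bullet> n = 0"
  shows "(\<forall>s\<in>W0. \<forall>t\<in>W0. phi0 x s t = 0) \<longleftrightarrow> x \<bullet> u = 0 \<and> x \<bullet> v = 0"
proof
  assume "x \<bullet> u = 0 \<and> x \<bullet> v = 0"
  then have "x \<in> W0" using assms by (simp add: W0_def)
  then show "\<forall>s\<in>W0. \<forall>t\<in>W0. phi0 x s t = 0" using phi0_W0_eq_0 by blast
next
  assume *: "\<forall>s\<in>W0. \<forall>t\<in>W0. phi0 x s t = 0"
  define y where "y = (x \<bullet> u) *\<^sub>R u + (x \<bullet> v) *\<^sub>R v"
  have "x - y \<in> W0"
    using assms uv n_orth
    by (simp add: W0_def y_def inner_diff_left inner_left_distrib inner_commute[of v u])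
  then have y0: "phi0 y s t = 0" if "s \<in> W0" "t \<in> W0" for s t
    using *  phi0_W0_eq_0[of "x - y" s t] that by (simp add: phi0_simps)
  \<comment> \<open>a nonzero vector orthogonal to \<open>u\<close>, \<open>v\<close> and \<open>n\<close>\<close>
  have "dim {u, v, n} < DIM(real ^ 7)"
    using dim_le_card'[of "{u, v, n}"] card_insert_le_m1[of 3 "{v, n}" u] card_insert_le_m1[of 2 "{n}" v]
    by simp
  then obtain s where s: "s \<noteq> 0" "\<And>z. z \<in> span {u, v, n} \<Longrightarrow> orthogonal s z"
    using orthogonal_to_subspace_exists by blast
  then have sW: "s \<in> W0"
    by (auto simp: W0_def orthogonal_def span_base)
  have tW: "cross0 y s \<in> W0"
    unfolding y_def cross0_simps using W0_subspace W0_cross[OF sW] by blast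
  have "y \<bullet> s = 0" using sW by (simp add: y_def W0_def inner_left_distrib inner_right_distrib inner_commute[of _ s])
  moreover have "s \<bullet> cross0 y (cross0 y s) = phi0 y (cross0 y s) s"
    using phi0_rotate[of s y "cross0 y s"] by (simp add: inner_cross0)
  ultimately have "(y \<bullet> y) * (s \<bullet> s) = 0"
    using y0[OF tW sW] by (simp add: cross0_cross0)
  then have "y \<bullet> y = 0" using s(1) by simp
  then have "(x \<bullet> u)\<^sup>2 + (x \<bullet> v)\<^sup>2 = 0"
    using uv by (simp add: y_def inner_left_distrib inner_right_distrib inner_commute[of v u] power2_eq_square)
  then show "x \<bullet> u = 0 \<and> x \<bullet> v = 0" by (simp add: sum_power2_eq_zero_iff)
qed

definition "proj0 x = x - (x \<bullet> u) *\<^sub>R u - (x \<bullet> v) *\<^sub>R v - (x \<bullet> n) *\<^sub>R n"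

text \<open>The last property holds because \<open>n \<times> u = v\<close>, \<open>n \<times> v = -u\<close> and \<open>n \<times> n = 0\<close> are orthogonal to \<open>W0\<close>.
  It makes the complex structure commute with the projection to \<open>W\<close>.\<close>

lemma proj0: "proj0 x \<in> W0" "w \<in> W0 \<Longrightarrow> (x - proj0 x) \<bullet> w = 0" "w \<in> W0 \<Longrightarrow> phi0 n (proj0 x) w = phi0 n x w"
proof -
  show "proj0 x \<in> W0"
    using uv n_orth by (simp add: W0_def proj0_def inner_diff_left inner_commute[of v u] inner_commute[of n u]
        inner_commute[of n v])
  assume "w \<in> W0"
  then have w: "u \<bullet> w = 0" "v \<bullet> w = 0" "n \<bullet> w = 0" by (simp_all add: W0_def inner_commute)
  then show "(x - proj0 x) \<bullet> w = 0" by (simp add: proj0_def inner_diff_left inner_left_distrib)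
  have "phi0 n u w = w \<bullet> cross0 n u" "phi0 n v w = w \<bullet> cross0 n v"
    using phi0_rotate[of w n u] phi0_rotate[of w n v] by (simp_all add: inner_cross0)
  then have "phi0 n u w = 0" "phi0 n v w = 0" using w by (simp_all add: cross_n inner_commute[of w])
  then show "phi0 n (proj0 x) w = phi0 n x w"
    by (simp add: proj0_def linear_diff[OF phi0_linear(2)] linear_scale[OF phi0_linear(2)] phi0_repeat)
qed

end

section \<open>Tangent vectors and vector fields\<close>

locale smooth_manifold =
  fixes A :: "('a::{t2_space, second_countable_topology}, 'n::finite) chart set"
  assumes smooth_str: "smooth_structure A"
begin

lemma chart_is_chart: "c \<in> A \<Longrightarrow> is_chart c"
  by (rule bspec[OF smooth_str[unfolded smooth_structure_def, THEN conjunct1]])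

lemma chart_cover: "(\<Union>c\<in>A. fst c) = UNIV"
  by (rule smooth_str[unfolded smooth_structure_def, THEN conjunct2, THEN conjunct1])

lemma chart_compatible: "c \<in> A \<Longrightarrow> d \<in> A \<Longrightarrow> compatible c d"
  by (rule bspec[OF bspec[OF smooth_str[unfolded smooth_structure_def, THEN conjunct2, THEN conjunct2, THEN conjunct1]]])

lemma chart_open: "c \<in> A \<Longrightarrow> open (fst c)"
  and chart_open_image: "c \<in> A \<Longrightarrow> open (snd c ` fst c)"
  and chart_homeomorphism: "c \<in> A \<Longrightarrow> homeomorphism (fst c) (snd c ` fst c) (snd c) (chart_inv c)"
  using chart_is_chart unfolding is_chart_def by blast+

lemma chart_inv [simp]: "c \<in> A \<Longrightarrow> q \<in> fst c \<Longrightarrow> chart_inv c (snd c q) = q"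
  by (rule homeomorphism_apply1[OF chart_homeomorphism])

lemma chart_image_open:
  assumes "c \<in> A" "open U"
  shows "open (snd c ` (fst c \<inter> U))"
proof -
  have "openin (top_of_set (snd c ` fst c)) (snd c ` (fst c \<inter> U))"
    by (rule homeomorphism_imp_open_map[OF chart_homeomorphism[OF assms(1)] openin_open_Int[OF assms(2)]])
  then show ?thesis using chart_open_image[OF assms(1)] by (rule openin_open_trans)
qed

lemma ex_chart: "\<exists>c. c \<in> A \<and> p \<in> fst c"
  using chart_cover by blast

lemma transition_smooth:
  assumes "c \<in> A" "d \<in> A"
  shows "smooth_on (snd c ` (fst c \<inter> fst d)) (snd d \<circ> chart_inv c)"
  using chart_compatible[OF assms] unfolding compatible_def by blast

lemma transition_differentiable:
  assumes "c \<in> A" "d \<in> A" "p \<in> fst c" "p \<in> fst d"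
  shows "(snd d \<circ> chart_inv c) differentiable (at (snd c p))"
  using smooth_on_differentiable[OF transition_smooth[OF assms(1,2)]] assms(3,4) by blast

abbreviation jac where
  "jac c d p \<equiv> frechet_derivative (snd d \<circ> chart_inv c) (at (snd c p))"

lemma jac_linear:
  assumes "c \<in> A" "d \<in> A" "p \<in> fst c" "p \<in> fst d"
  shows "linear (jac c d p)"
  using has_derivative_linear[OF has_frechet[OF transition_differentiable[OF assms]]] .

text \<open>Change of variables for an arbitrary function on the manifold. The chain rule for the Jacobians of
  coordinate changes and the independence of \<open>dir_deriv\<close> of the chart are special cases.\<close>

lemma has_derivative_change_chart:
  assumes c: "c \<in> A" "p \<in> fst c" and d: "d \<in> A" "p \<in> fst d"
    and F: "((\<lambda>x. F (chart_inv d x)) has_derivative L) (at (snd d p))"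
  shows "((\<lambda>x. F (chart_inv c x)) has_derivative (\<lambda>v. L (jac c d p v))) (at (snd c p))"
proof -
  have "((\<lambda>x. F (chart_inv d ((snd d \<circ> chart_inv c) x))) has_derivative (\<lambda>v. L (jac c d p v))) (at (snd c p))"
    by (rule has_derivative_compose[OF has_frechet[OF transition_differentiable]])
      (use c d F in auto)
  then show ?thesis
    by (rule has_derivative_transform_within_open[OF _ chart_image_open[OF c(1) chart_open[OF d(1)]]])
      (use c d in auto)
qed

lemma jac_chain:
  assumes "c \<in> A" "p \<in> fst c" "d \<in> A" "p \<in> fst d" "e \<in> A" "p \<in> fst e"
  shows "jac c e p v = jac d e p (jac c d p v)"
proof -
  have "((\<lambda>x. snd e (chart_inv d x)) has_derivative jac d e p) (at (snd d p))"
    using has_frechet[OF transition_differentiable[of d e p]] assms by (simp add: o_def)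
  from frechet_derivative_eqI[OF has_derivative_change_chart[OF assms(1-4) this]]
  show ?thesis by (simp add: o_def)
qed

lemma jac_self:
  assumes "c \<in> A" "p \<in> fst c"
  shows "jac c c p v = v"
proof -
  have "((snd c \<circ> chart_inv c) has_derivative (\<lambda>v. v)) (at (snd c p))"
    by (rule has_derivative_transform_within_open[OF has_derivative_ident chart_image_open[OF assms(1) chart_open[OF assms(1)]]])
      (use assms in auto)
  from frechet_derivative_eqI[OF this] show ?thesis by simp
qed

lemma tangent_spaceI:
  assumes "\<And>c d. c \<in> A \<Longrightarrow> p \<in> fst c \<Longrightarrow> d \<in> A \<Longrightarrow> p \<in> fst d \<Longrightarrow> v d = jac c d p (v c)"
    and "\<And>c. \<not> (c \<in> A \<and> p \<in> fst c) \<Longrightarrow> v c = 0"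
  shows "v \<in> tangent_space A p"
  unfolding tangent_space_def mem_Collect_eq
proof
  fix c
  show "if c \<in> A \<and> p \<in> fst c then \<forall>d\<in>A. p \<in> fst d \<longrightarrow> v d = jac c d p (v c) else v c = 0"
    unfolding if_split[of "\<lambda>b. b"] using assms(1)[of c] assms(2)[of c] by blast
qed

lemma tangent_comp:
  assumes "v \<in> tangent_space A p" "c \<in> A" "p \<in> fst c" "d \<in> A" "p \<in> fst d"
  shows "v d = jac c d p (v c)"
proof -
  have "if c \<in> A \<and> p \<in> fst c then \<forall>d\<in>A. p \<in> fst d \<longrightarrow> v d = jac c d p (v c) else v c = 0"
    using assms(1) unfolding tangent_space_def mem_Collect_eq by (rule spec)
  then have "\<forall>d\<in>A. p \<in> fst d \<longrightarrow> v d = jac c d p (v c)"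
    unfolding if_split[of "\<lambda>b. b"] using assms(2,3) by blast
  then show ?thesis using assms(4,5) by blast
qed

lemma tangent_outside:
  assumes "v \<in> tangent_space A p" "\<not> (c \<in> A \<and> p \<in> fst c)"
  shows "v c = 0"
proof -
  have "if c \<in> A \<and> p \<in> fst c then \<forall>d\<in>A. p \<in> fst d \<longrightarrow> v d = jac c d p (v c) else v c = 0"
    using assms(1) unfolding tangent_space_def mem_Collect_eq by (rule spec)
  then show ?thesis unfolding if_split[of "\<lambda>b. b"] using assms(2) by blast
qed

lemma tangent_eqI:
  assumes "v \<in> tangent_space A p" "w \<in> tangent_space A p" "c \<in> A" "p \<in> fst c" "v c = w c"
  shows "v = w"
proof
  fix d
  show "v d = w d"
  proof (cases "d \<in> A \<and> p \<in> fst d")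
    case True
    then show ?thesis using tangent_comp[OF assms(1,3,4), of d] tangent_comp[OF assms(2,3,4), of d] assms(5) by simp
  next
    case False
    then have "v d = 0" "w d = 0" using assms(1,2)[THEN tangent_outside] by blast+
    then show ?thesis by simp
  qed
qed

lemma tangent_subspace: "subspace (tangent_space A p)"
proof (rule subspaceI)
  show "0 \<in> tangent_space A p"
    by (rule tangent_spaceI) (simp_all only: zero_fun_apply linear_0[OF jac_linear])
next
  fix v w assume vw: "v \<in> tangent_space A p" "w \<in> tangent_space A p"
  show "v + w \<in> tangent_space A p"
  proof (rule tangent_spaceI)
    fix c d assume cd: "c \<in> A" "p \<in> fst c" "d \<in> A" "p \<in> fst d"
    show "(v + w) d = jac c d p ((v + w) c)"
      unfolding plus_fun_apply tangent_comp[OF vw(1) cd] tangent_comp[OF vw(2) cd]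
      by (rule linear_add[OF jac_linear, symmetric]) (use cd in auto)
  next
    fix c assume c: "\<not> (c \<in> A \<and> p \<in> fst c)"
    show "(v + w) c = 0"
      unfolding plus_fun_apply tangent_outside[OF vw(1) c] tangent_outside[OF vw(2) c] by (rule add_0)
  qed
next
  fix r v assume v: "v \<in> tangent_space A p"
  show "r *\<^sub>R v \<in> tangent_space A p"
  proof (rule tangent_spaceI)
    fix c d assume cd: "c \<in> A" "p \<in> fst c" "d \<in> A" "p \<in> fst d"
    show "(r *\<^sub>R v) d = jac c d p ((r *\<^sub>R v) c)"
      unfolding scaleR_fun_def tangent_comp[OF v cd]
      by (rule linear_scale[OF jac_linear, symmetric]) (use cd in auto)
  next
    fix c assume c: "\<not> (c \<in> A \<and> p \<in> fst c)"
    show "(r *\<^sub>R v) c = 0"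
      unfolding scaleR_fun_def tangent_outside[OF v c] by (rule scaleR_zero_right)
  qed
qed

lemmas tangent_closed = subspace_add[OF tangent_subspace] subspace_diff[OF tangent_subspace]
  subspace_scale[OF tangent_subspace] subspace_0[OF tangent_subspace]

text \<open>For varying \<open>p\<close> this is the field with constant coefficients \<open>a\<close> in the chart \<open>c\<close>.\<close>

definition tvec_of :: "('a, 'n) chart \<Rightarrow> 'a \<Rightarrow> real ^ 'n \<Rightarrow> ('a, 'n) tvec" where
  "tvec_of c p a = (\<lambda>d. if d \<in> A \<and> p \<in> fst d then jac c d p a else 0)"

lemma tvec_of_tangent:
  assumes "c \<in> A" "p \<in> fst c"
  shows "tvec_of c p a \<in> tangent_space A p"
proof (rule tangent_spaceI)
  fix d e assume "d \<in> A" "p \<in> fst d" "e \<in> A" "p \<in> fst e"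
  then show "tvec_of c p a e = jac d e p (tvec_of c p a d)"
    using jac_chain[of c p d e a] assms by (simp add: tvec_of_def)
qed (unfold tvec_of_def, rule if_not_P)

lemma tvec_of_self: "c \<in> A \<Longrightarrow> p \<in> fst c \<Longrightarrow> tvec_of c p a c = a"
  using jac_self by (simp add: tvec_of_def)

lemma tvec_of_comp:
  assumes "c \<in> A" "p \<in> fst c" "v \<in> tangent_space A p"
  shows "tvec_of c p (v c) = v"
  using tangent_eqI[OF tvec_of_tangent assms(3)] tvec_of_self assms by blast

lemma smooth_fun_smooth:
  "smooth_fun A U f \<Longrightarrow> c \<in> A \<Longrightarrow> smooth_on (snd c ` (fst c \<inter> U)) (\<lambda>x. f (chart_inv c x))"
  unfolding smooth_fun_def by (rule bspec)

lemma smooth_fun_differentiable: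
  assumes "smooth_fun A U f" "p \<in> U" "c \<in> A" "p \<in> fst c"
  shows "(\<lambda>x. f (chart_inv c x)) differentiable (at (snd c p))"
  by (rule smooth_on_differentiable[OF smooth_fun_smooth[OF assms(1,3)]]) (use assms in blast)

lemma dir_deriv_chart:
  assumes f: "smooth_fun A U f" "p \<in> U" and v: "v \<in> tangent_space A p" and c: "c \<in> A" "p \<in> fst c"
  shows "dir_deriv A p v f = frechet_derivative (\<lambda>x. f (chart_inv c x)) (at (snd c p)) (v c)"
proof -
  define d where "d = (SOME c. c \<in> A \<and> p \<in> fst c)"
  have d: "d \<in> A" "p \<in> fst d" using someI_ex[OF ex_chart[of p]] by (auto simp: d_def)
  have "((\<lambda>x. f (chart_inv d x)) has_derivative
     (\<lambda>v. frechet_derivative (\<lambda>x. f (chart_inv c x)) (at (snd c p)) (jac d c p v))) (at (snd d p))"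
    by (rule has_derivative_change_chart[OF d c has_frechet[OF smooth_fun_differentiable[OF f c]]])
  from frechet_derivative_eqI[OF this] show ?thesis
    unfolding tangent_comp[OF v d c] by (simp add: dir_deriv_def d_def[symmetric])
qed

lemma smooth_fun_powr:
  assumes "open U" "smooth_fun A U f" "\<And>q. q \<in> U \<Longrightarrow> f q > 0"
  shows "smooth_fun A U (\<lambda>q. f q powr a)"
  unfolding smooth_fun_def
proof
  fix c assume c: "c \<in> A"
  show "smooth_on (snd c ` (fst c \<inter> U)) (\<lambda>x. f (chart_inv c x) powr a)"
    by (rule smooth_on_powr[OF chart_image_open[OF c assms(1)] smooth_fun_smooth[OF assms(2) c]])
      (use c assms(3) in auto)
qed

lemma vector_field_tangent: "vector_field A U V \<Longrightarrow> q \<in> U \<Longrightarrow> V q \<in> tangent_space A q"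
  by (simp add: vector_field_def)

lemma vector_field_smooth:
  "vector_field A U V \<Longrightarrow> c \<in> A \<Longrightarrow> smooth_on (snd c ` (fst c \<inter> U)) (\<lambda>x. V (chart_inv c x) c)"
  by (simp add: vector_field_def)

lemma vector_fieldI:
  assumes "\<And>q. q \<in> U \<Longrightarrow> V q \<in> tangent_space A q"
    and "\<And>c. c \<in> A \<Longrightarrow> smooth_on (snd c ` (fst c \<inter> U)) (\<lambda>x. V (chart_inv c x) c)"
  shows "vector_field A U V"
  unfolding vector_field_def using assms by blast

lemma vector_field_cong:
  assumes "open U" "\<And>q. q \<in> U \<Longrightarrow> W q = V q" "vector_field A U V"
  shows "vector_field A U W"
proof (rule vector_fieldI)
  fix c assume c: "c \<in> A"
  show "smooth_on (snd c ` (fst c \<inter> U)) (\<lambda>x. W (chart_inv c x) c)"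
    by (rule smooth_on_cong[OF chart_image_open[OF c assms(1)] _ vector_field_smooth[OF assms(3) c]])
      (use c assms(2) in auto)
qed (simp only: assms(2) vector_field_tangent[OF assms(3)])

lemma vector_field_subset:
  assumes "vector_field A U V" "U' \<subseteq> U"
  shows "vector_field A U' V"
proof (rule vector_fieldI)
  fix c assume "c \<in> A"
  from vector_field_smooth[OF assms(1) this] show "smooth_on (snd c ` (fst c \<inter> U')) (\<lambda>x. V (chart_inv c x) c)"
    by (rule smooth_on_subset) (use assms in auto)
qed (use assms vector_field_tangent in blast)

lemma vector_field_add:
  assumes "open U" "vector_field A U V" "vector_field A U W"
  shows "vector_field A U (\<lambda>q. V q + W q)"
proof (rule vector_fieldI)
  fix c assume c: "c \<in> A"
  show "smooth_on (snd c ` (fst c \<inter> U)) (\<lambda>x. (V (chart_inv c x) + W (chart_inv c x)) c)"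
    unfolding plus_fun_apply
    by (rule smooth_on_add[OF chart_image_open[OF c assms(1)] vector_field_smooth[OF assms(2) c]
       vector_field_smooth[OF assms(3) c]])
qed (rule tangent_closed(1)[OF vector_field_tangent[OF assms(2)] vector_field_tangent[OF assms(3)]])

lemma vector_field_scaleR:
  assumes "open U" "smooth_fun A U f" "vector_field A U W"
  shows "vector_field A U (\<lambda>q. f q *\<^sub>R W q)"
proof (rule vector_fieldI)
  fix c assume c: "c \<in> A"
  have "smooth_on (snd c ` (fst c \<inter> U)) (\<lambda>x. f (chart_inv c x))"
    using assms(2) c by (simp add: smooth_fun_def)
  then show "smooth_on (snd c ` (fst c \<inter> U)) (\<lambda>x. (f (chart_inv c x) *\<^sub>R W (chart_inv c x)) c)"
    unfolding scaleR_fun_def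
    by (rule smooth_on_scaleR[OF chart_image_open[OF c assms(1)] _ vector_field_smooth[OF assms(3) c]])
qed (rule tangent_closed(3)[OF vector_field_tangent[OF assms(3)]])

lemma smooth_fun_const: "smooth_fun A U (\<lambda>q. k)"
  unfolding smooth_fun_def using smooth_on_const by blast

lemma vector_field_zero: "vector_field A U (\<lambda>q. 0)"
  by (rule vector_fieldI) (simp_all only: zero_fun_apply smooth_on_const tangent_closed(4))

lemma vector_field_sum:
  assumes "open U" "finite I" "\<And>i. i \<in> I \<Longrightarrow> vector_field A U (V i)"
  shows "vector_field A U (\<lambda>q. \<Sum>i\<in>I. V i q)"
  using assms(2,3)
proof (induction I rule: finite_induct)
  case empty
  show ?case unfolding sum.empty by (rule vector_field_zero)
next
  case (insert i I)
  show ?case unfolding sum.insert[OF insert(1,2)]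
    by (rule vector_field_add[OF assms(1)]) (use insert in blast)+
qed

lemma vector_field_diff:
  assumes "open U" "vector_field A U V" "vector_field A U W"
  shows "vector_field A U (\<lambda>q. V q - W q)"
  using vector_field_add[OF assms(1,2) vector_field_scaleR[OF assms(1) smooth_fun_const[of _ "-1"] assms(3)]]
  unfolding scaleR_minus_left scaleR_one add_uminus_conv_diff .

text \<open>In another chart the components of this field are Jacobian coefficients of the coordinate change,
  evaluated at the coordinates in \<open>c\<close>, so they are compositions of smooth maps.\<close>

lemma vector_field_tvec_of:
  assumes "c \<in> A" "open U" "U \<subseteq> fst c"
  shows "vector_field A U (\<lambda>q. tvec_of c q a)"
proof (rule vector_fieldI)
  fix d assume d: "d \<in> A"
  have o: "open (snd d ` (fst d \<inter> U))" by (rule chart_image_open[OF d assms(2)])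
  have "smooth_on (snd d ` (fst d \<inter> U)) (snd c \<circ> chart_inv d)"
    by (rule smooth_on_subset[OF transition_smooth[OF d assms(1)]]) (use assms in auto)
  moreover have "smooth_on (snd c ` (fst c \<inter> fst d)) (\<lambda>y. frechet_derivative (snd d \<circ> chart_inv c) (at y) a)"
    by (rule smooth_on_frechet[OF transition_smooth[OF assms(1) d]])
  ultimately have "smooth_on (snd d ` (fst d \<inter> U))
     (\<lambda>x. frechet_derivative (snd d \<circ> chart_inv c) (at ((snd c \<circ> chart_inv d) x)) a)"
    by (rule smooth_on_compose[OF o]) (use assms d in auto)
  then show "smooth_on (snd d ` (fst d \<inter> U)) (\<lambda>x. tvec_of c (chart_inv d x) a d)"
    by (rule smooth_on_cong[OF o, rotated]) (use d in \<open>auto simp: tvec_of_def\<close>)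
qed (rule tvec_of_tangent, use assms in auto)

end

section \<open>Orthonormal frames and the cross product on the manifold\<close>

lemma linear_form_onD:
  assumes "linear_form_on E f"
  shows "x \<in> E \<Longrightarrow> y \<in> E \<Longrightarrow> f (x + y) = f x + f y" and "x \<in> E \<Longrightarrow> f (r *\<^sub>R x) = r * f x"
proof -
  show "x \<in> E \<Longrightarrow> y \<in> E \<Longrightarrow> f (x + y) = f x + f y"
    by (rule assms[unfolded linear_form_on_def, THEN conjunct1, rule_format])
  show "x \<in> E \<Longrightarrow> f (r *\<^sub>R x) = r * f x"
    by (rule assms[unfolded linear_form_on_def, THEN conjunct2, rule_format])
qed

lemma linear_form_on_sum:
  assumes "subspace E" "linear_form_on E f" "\<And>i. i \<in> I \<Longrightarrow> e i \<in> E"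
  shows "f (\<Sum>i\<in>I. x i *\<^sub>R e i) = (\<Sum>i\<in>I. x i * f (e i))"
proof -
  note f = linear_form_onD[OF assms(2)]
  have f0: "f 0 = 0"
    using f(2)[OF subspace_0[OF assms(1)], of 0] by (simp only: scaleR_zero_left mult_zero_left)
  show ?thesis
  proof (cases "finite I")
    case True
    then show ?thesis using assms(3)
    proof (induction I rule: finite_induct)
      case empty
      show ?case unfolding sum.empty by (rule f0)
    next
      case (insert j I)
      have j: "e j \<in> E" and I: "(\<Sum>i\<in>I. x i *\<^sub>R e i) \<in> E"
        using insert.prems by (auto intro!: subspace_sum[OF assms(1)] subspace_scale[OF assms(1)])
      have "f (\<Sum>i\<in>I. x i *\<^sub>R e i) = (\<Sum>i\<in>I. x i * f (e i))"
        by (rule insert.IH) (rule insert.prems[OF insertI2])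
      then show ?case
        unfolding sum.insert[OF insert(1,2)] f(1)[OF subspace_scale[OF assms(1) j] I] f(2)[OF j]
        by (rule arg_cong)
    qed
  next
    case False
    show ?thesis unfolding sum.infinite[OF False] by (rule f0)
  qed
qed

text \<open>The vectors of a frame are numbered by \<open>1, ..., 7\<close> as natural numbers, which allows induction on
  their number; this is what relates these numbers to coordinate indices.\<close>

lemma of_nat_7_inj:
  assumes "i \<in> {1..7}" "j \<in> {1..7}" "(of_nat i :: 7) = of_nat j"
  shows "i = j"
proof -
  have "x \<in> of_nat ` {1..7}" for x :: 7
  proof -
    have "of_nat k \<in> (of_nat ` {1..7} :: 7 set)" if "1 \<le> k" "k \<le> 7" for k :: nat
      using that by (intro imageI) simp
    from this[of 1] this[of 2] this[of 3] this[of 4] this[of 5] this[of 6] this[of 7]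
    show ?thesis unfolding of_nat_1 of_nat_numeral
      using exhaust_7[of x] by (elim disjE) simp_all
  qed
  then have "of_nat ` {1..7} = (UNIV :: 7 set)" by blast
  then have "inj_on (of_nat :: nat \<Rightarrow> 7) {1..7}"
    by (intro eq_card_imp_inj_on) simp_all
  then show ?thesis using assms(3,1,2) by (rule inj_onD)
qed

lemma sum_apply: "(\<Sum>i\<in>I. f i) c = (\<Sum>i\<in>I. f i c)"
  by (induction I rule: infinite_finite_induct) simp_all

locale G2 =
  fixes A :: "('a::{t2_space, second_countable_topology}, 7) chart set"
    and \<phi> :: "'a \<Rightarrow> ('a, 7) tvec \<Rightarrow> ('a, 7) tvec \<Rightarrow> ('a, 7) tvec \<Rightarrow> real"
    and g :: "'a \<Rightarrow> ('a, 7) tvec \<Rightarrow> ('a, 7) tvec \<Rightarrow> real"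
    and D :: "('a, 7) connection"
  assumes G2: "G2_manifold A \<phi> g D"
begin

lemma
  shows G2_smooth: "smooth_structure A" and three_form: "three_form A \<phi>" and metric: "riemannian_metric A g"
    and frame_exists: "\<exists>e. g2_frame A \<phi> p e"
    and frame_orthonormal: "g2_frame A \<phi> p e \<Longrightarrow> g p (e i) (e j) = (if i = j then 1 else 0)"
    and LC: "levi_civita A g D" and parallel: "parallel_three_form A D \<phi>"
proof -
  note G = G2[unfolded G2_manifold_def]
  show "smooth_structure A" by (rule G[THEN conjunct1])
  note G = G[THEN conjunct2]
  show "three_form A \<phi>" by (rule G[THEN conjunct1])
  note G = G[THEN conjunct2]
  show "riemannian_metric A g" by (rule G[THEN conjunct1])
  note G = G[THEN conjunct2]
  show "\<exists>e. g2_frame A \<phi> p e" by (rule G[THEN conjunct1, THEN spec])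
  note G = G[THEN conjunct2]
  show "g p (e i) (e j) = (if i = j then 1 else 0)" if "g2_frame A \<phi> p e"
    by (rule G[THEN conjunct1, rule_format, OF that])
  note G = G[THEN conjunct2]
  show "levi_civita A g D" by (rule G[THEN conjunct1])
  show "parallel_three_form A D \<phi>" by (rule G[THEN conjunct2])
qed

sublocale smooth_manifold A
  by unfold_locales (rule G2_smooth)

abbreviation T where "T \<equiv> tangent_space A"
abbreviation cr where "cr \<equiv> cross A \<phi> g"

lemma g_linear_form: "u \<in> T p \<Longrightarrow> linear_form_on (T p) (g p u)"
  and g_sym: "u \<in> T p \<Longrightarrow> v \<in> T p \<Longrightarrow> g p u v = g p v u"
  and g_pos: "u \<in> T p \<Longrightarrow> u \<noteq> 0 \<Longrightarrow> g p u u > 0"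
proof -
  note M = metric[unfolded riemannian_metric_def Let_def, THEN conjunct1, THEN spec, of p]
  show "u \<in> T p \<Longrightarrow> linear_form_on (T p) (g p u)"
    by (rule M[THEN conjunct1, rule_format])
  show "u \<in> T p \<Longrightarrow> v \<in> T p \<Longrightarrow> g p u v = g p v u"
    by (rule M[THEN conjunct2, THEN conjunct1, rule_format])
  show "u \<in> T p \<Longrightarrow> u \<noteq> 0 \<Longrightarrow> g p u u > 0"
    by (rule M[THEN conjunct2, THEN conjunct2, rule_format])
qed

lemma g_smooth:
  assumes "open U" "vector_field A U V" "vector_field A U W"
  shows "smooth_fun A U (\<lambda>q. g q (V q) (W q))"
  by (rule metric[unfolded riemannian_metric_def, THEN conjunct2, rule_format]) (intro conjI assms)

lemmas g_add_right = linear_form_onD(1)[OF g_linear_form]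
lemmas g_scale_right = linear_form_onD(2)[OF g_linear_form]

lemma g_add_left: "u \<in> T p \<Longrightarrow> v \<in> T p \<Longrightarrow> w \<in> T p \<Longrightarrow> g p (v + w) u = g p v u + g p w u"
  using g_add_right[of u p v w] g_sym[of u p "v + w"] g_sym[of u p v] g_sym[of u p w] tangent_closed(1)[of v p w]
  by simp

lemma g_scale_left: "u \<in> T p \<Longrightarrow> v \<in> T p \<Longrightarrow> g p (r *\<^sub>R v) u = r * g p v u"
  using g_scale_right[of u p v r] g_sym[of u p "r *\<^sub>R v"] g_sym[of u p v] tangent_closed(3)[of v p r]
  by simp

lemma g_diff_left: "u \<in> T p \<Longrightarrow> v \<in> T p \<Longrightarrow> w \<in> T p \<Longrightarrow> g p (v - w) u = g p v u - g p w u"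
  using g_add_left[of u p "v - w" w] tangent_closed(2)[of v p w] by simp

lemma phi_swap12: "u \<in> T p \<Longrightarrow> v \<in> T p \<Longrightarrow> w \<in> T p \<Longrightarrow> \<phi> p v u w = - \<phi> p u v w"
  and phi_swap23: "u \<in> T p \<Longrightarrow> v \<in> T p \<Longrightarrow> w \<in> T p \<Longrightarrow> \<phi> p u w v = - \<phi> p u v w"
proof -
  note M = three_form[unfolded three_form_def Let_def, THEN conjunct1, THEN spec, of p]
  note M = M[THEN conjunct2, rule_format]
  show "u \<in> T p \<Longrightarrow> v \<in> T p \<Longrightarrow> w \<in> T p \<Longrightarrow> \<phi> p v u w = - \<phi> p u v w"
    by (rule M[THEN conjunct1])
  show "u \<in> T p \<Longrightarrow> v \<in> T p \<Longrightarrow> w \<in> T p \<Longrightarrow> \<phi> p u w v = - \<phi> p u v w"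
    by (rule M[THEN conjunct2])
qed

lemma phi_rotate: "u \<in> T p \<Longrightarrow> v \<in> T p \<Longrightarrow> w \<in> T p \<Longrightarrow> \<phi> p u v w = \<phi> p v w u"
  using phi_swap12[of v p u w] phi_swap23[of v p u w] by simp

lemma phi_smooth:
  assumes "open U" "vector_field A U V1" "vector_field A U V2" "vector_field A U V3"
  shows "smooth_fun A U (\<lambda>q. \<phi> q (V1 q) (V2 q) (V3 q))"
  by (rule three_form[unfolded three_form_def, THEN conjunct2, rule_format]) (intro conjI assms)

lemma D_tangent:
  assumes "open U" "vector_field A U S" "p \<in> U" "v \<in> T p"
  shows "D p v S \<in> T p"
proof -
  note M = LC[unfolded levi_civita_def, THEN conjunct1, unfolded affine_connection_def, THEN spec, THEN spec, of U S]
  show ?thesis by (rule M[THEN mp, THEN conjunct1, rule_format]) (intro conjI assms)+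
qed

lemma D_metric:
  assumes "open U" "vector_field A U V" "vector_field A U W" "p \<in> U" "v \<in> T p"
  shows "dir_deriv A p v (\<lambda>q. g q (V q) (W q)) = g p (D p v V) (W p) + g p (V p) (D p v W)"
proof -
  note M = LC[unfolded levi_civita_def, THEN conjunct2, THEN spec, THEN spec, THEN spec, of U V W]
  show ?thesis by (rule M[THEN mp, THEN conjunct2, rule_format]) (intro conjI assms)+
qed

lemma D_phi:
  assumes "open U" "vector_field A U V1" "vector_field A U V2" "vector_field A U V3" "p \<in> U" "v \<in> T p"
  shows "dir_deriv A p v (\<lambda>q. \<phi> q (V1 q) (V2 q) (V3 q)) =
    \<phi> p (D p v V1) (V2 p) (V3 p) + \<phi> p (V1 p) (D p v V2) (V3 p) + \<phi> p (V1 p) (V2 p) (D p v V3)"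
proof -
  note M = parallel[unfolded parallel_three_form_def, THEN spec, THEN spec, THEN spec, THEN spec, of U V1 V2 V3]
  have "dir_deriv A p v (\<lambda>q. \<phi> q (V1 q) (V2 q) (V3 q))
           - \<phi> p (D p v V1) (V2 p) (V3 p)
           - \<phi> p (V1 p) (D p v V2) (V3 p)
           - \<phi> p (V1 p) (V2 p) (D p v V3) = 0"
    by (rule M[THEN mp, rule_format]) (intro conjI assms)+
  then show ?thesis by linarith
qed

text \<open>Coordinates of the tangent space in a \<open>G\<^sub>2\<close>-frame: a linear isometry from \<open>\<real>\<^sup>7\<close> that pulls back
  the three-form to \<open>phi0\<close>.\<close>

definition G2_iso :: "'a \<Rightarrow> (real ^ 7 \<Rightarrow> ('a, 7) tvec) \<Rightarrow> bool" where
  "G2_iso p L \<longleftrightarrow> linear L \<and> range L = T p \<and> (\<forall>x y. g p (L x) (L y) = x \<bullet> y) \<and>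
     (\<forall>x y z. \<phi> p (L x) (L y) (L z) = phi0 x y z)"

lemma ex_G2_iso: "\<exists>L. G2_iso p L"
proof -
  obtain e where e: "g2_frame A \<phi> p e" using frame_exists by blast
  then have inj: "inj e" and span: "span (range e) = T p"
    and phi: "\<And>x y z. \<phi> p (\<Sum>i\<in>UNIV. x $ i *\<^sub>R e i) (\<Sum>i\<in>UNIV. y $ i *\<^sub>R e i) (\<Sum>i\<in>UNIV. z $ i *\<^sub>R e i)
        = phi0 x y z"
    by (auto simp: g2_frame_def)
  have eT: "e i \<in> T p" for i unfolding span[symmetric] by (rule span_base) simp
  define L where "L x = (\<Sum>i\<in>UNIV. x $ i *\<^sub>R e i)" for x :: "real ^ 7"
  have lin: "linear L"
    by (rule linearI) (simp_all only: L_def vector_add_component vector_scaleR_component scaleR_left_distrib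
       sum.distrib scaleR_sum_right scaleR_scaleR real_scaleR_def)
  have LT: "L x \<in> T p" for x
    unfolding L_def by (intro subspace_sum[OF tangent_subspace] tangent_closed eT)
  have surj: "T p \<subseteq> range L"
  proof
    fix v assume "v \<in> T p"
    then obtain a where "v = (\<Sum>w\<in>range e. a w *\<^sub>R w)"
      unfolding span[symmetric] by (auto simp: span_finite)
    then have "v = L (\<chi> i. a (e i))"
      by (simp only: L_def sum.reindex[OF inj] o_def vec_lambda_beta)
    then show "v \<in> range L" by blast
  qed
  have "g p (L x) (L y) = x \<bullet> y" for x y
  proof -
    have *: "g p (e j) (L y) = y $ j" for j
      unfolding L_def linear_form_on_sum[OF tangent_subspace g_linear_form[OF eT] eT] frame_orthonormal[OF e]
      by (simp add: if_distrib cong: if_cong)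
    have "g p (L x) (L y) = g p (L y) (L x)" by (rule g_sym[OF LT LT])
    also have "\<dots> = (\<Sum>j\<in>UNIV. x $ j * g p (L y) (e j))"
      unfolding L_def[of x] by (rule linear_form_on_sum[OF tangent_subspace g_linear_form[OF LT] eT])
    also have "\<dots> = (\<Sum>j\<in>UNIV. x $ j * y $ j)"
      unfolding g_sym[OF LT eT] * ..
    finally show ?thesis by (simp add: inner_vec_def)
  qed
  then show ?thesis
    unfolding G2_iso_def using lin LT surj phi[folded L_def] by (intro exI[of _ L]) auto
qed

lemma G2_isoD:
  assumes "G2_iso p L"
  shows "linear L" "range L = T p" "L x \<in> T p" "g p (L x) (L y) = x \<bullet> y" "\<phi> p (L x) (L y) (L z) = phi0 x y z"
  using assms by (auto simp: G2_iso_def)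

lemma G2_iso_surj: "G2_iso p L \<Longrightarrow> v \<in> T p \<Longrightarrow> \<exists>x. v = L x"
  using G2_isoD(2) by blast

lemma cross_iso:
  assumes L: "G2_iso p L"
  shows "cr p (L x) (L y) = L (cross0 x y)"
  unfolding cross_def
proof (rule the_equality)
  have "g p u (L (cross0 x y)) = \<phi> p u (L x) (L y)" if u: "u \<in> T p" for u
  proof -
    obtain w where "u = L w" using G2_iso_surj[OF L u] by blast
    then show ?thesis by (simp only: G2_isoD(4,5)[OF L] inner_cross0)
  qed
  then show "L (cross0 x y) \<in> T p \<and> (\<forall>u\<in>T p. g p u (L (cross0 x y)) = \<phi> p u (L x) (L y))"
    using G2_isoD(3)[OF L] by blast
next
  fix z assume z: "z \<in> T p \<and> (\<forall>u\<in>T p. g p u z = \<phi> p u (L x) (L y))"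
  then obtain w where w: "z = L w" using G2_iso_surj[OF L] by blast
  have "(w - cross0 x y) \<bullet> w = phi0 (w - cross0 x y) x y"
    using z[THEN conjunct2, rule_format, OF G2_isoD(3)[OF L], of "w - cross0 x y"]
    unfolding w G2_isoD(4,5)[OF L] .
  then have "(w - cross0 x y) \<bullet> (w - cross0 x y) = 0"
    by (simp only: inner_diff_right inner_cross0 diff_self)
  then show "z = L (cross0 x y)" by (simp add: w)
qed

lemma cross_tangent: "v \<in> T p \<Longrightarrow> w \<in> T p \<Longrightarrow> cr p v w \<in> T p"
  and g_cross: "u \<in> T p \<Longrightarrow> v \<in> T p \<Longrightarrow> w \<in> T p \<Longrightarrow> g p u (cr p v w) = \<phi> p u v w"
proof -
  obtain L where L: "G2_iso p L" using ex_G2_iso by blast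
  {
    assume "v \<in> T p" "w \<in> T p"
    then obtain y z where vw: "v = L y" "w = L z" using G2_iso_surj[OF L] by blast
    show "cr p v w \<in> T p" unfolding vw cross_iso[OF L] by (rule G2_isoD(3)[OF L])
    assume "u \<in> T p"
    then obtain x where u: "u = L x" using G2_iso_surj[OF L] by blast
    show "g p u (cr p v w) = \<phi> p u v w"
      unfolding u vw cross_iso[OF L] G2_isoD(4,5)[OF L] by (rule inner_cross0)
  }
qed

definition orthonormal_fields :: "'a set \<Rightarrow> nat \<Rightarrow> (nat \<Rightarrow> 'a \<Rightarrow> ('a, 7) tvec) \<Rightarrow> bool" where
  "orthonormal_fields U k E \<longleftrightarrow> (\<forall>i\<in>{1..k}. vector_field A U (E i)) \<and>
     (\<forall>q\<in>U. \<forall>i\<in>{1..k}. \<forall>j\<in>{1..k}. g q (E i q) (E j q) = (if i = j then 1 else 0))"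

lemma orthonormal_fieldsD:
  assumes "orthonormal_fields U k E"
  shows "i \<in> {1..k} \<Longrightarrow> vector_field A U (E i)"
    and "q \<in> U \<Longrightarrow> i \<in> {1..k} \<Longrightarrow> E i q \<in> T q"
    and "q \<in> U \<Longrightarrow> i \<in> {1..k} \<Longrightarrow> j \<in> {1..k} \<Longrightarrow> g q (E i q) (E j q) = (if i = j then 1 else 0)"
proof -
  note M = assms[unfolded orthonormal_fields_def]
  show f: "i \<in> {1..k} \<Longrightarrow> vector_field A U (E i)" by (rule M[THEN conjunct1, rule_format])
  show "q \<in> U \<Longrightarrow> i \<in> {1..k} \<Longrightarrow> E i q \<in> T q" by (rule vector_field_tangent[OF f])
  show "q \<in> U \<Longrightarrow> i \<in> {1..k} \<Longrightarrow> j \<in> {1..k} \<Longrightarrow> g q (E i q) (E j q) = (if i = j then 1 else 0)"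
    by (rule M[THEN conjunct2, rule_format])
qed

lemma orthonormal_fields_subset:
  assumes "orthonormal_fields U k E" "U' \<subseteq> U"
  shows "orthonormal_fields U' k E"
  unfolding orthonormal_fields_def
  using vector_field_subset[OF orthonormal_fieldsD(1)[OF assms(1)] assms(2)] orthonormal_fieldsD(3)[OF assms(1)] assms(2)
  by blast

text \<open>Gram-Schmidt process for the coordinate fields of a chart. The triangular shape of the components
  is what makes the process work (a coordinate field is never in the span of the earlier frame
  vectors), and in a slice chart it makes the first two vectors of the frame tangent to the surface and
  positively oriented.\<close>

lemma gram_schmidt:
  assumes c: "c \<in> A" "open U" "U \<subseteq> fst c" and "k \<le> 7"
  shows "\<exists>E. orthonormal_fields U k E \<and>
    (\<forall>q\<in>U. \<forall>i\<in>{1..k}. E i q c $ of_nat i > 0 \<and> (\<forall>j\<in>{i<..7}. E i q c $ of_nat j = 0))"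
  using \<open>k \<le> 7\<close>
proof (induction k)
  case 0
  show ?case by (simp add: orthonormal_fields_def)
next
  case (Suc k)
  then have "k \<le> 7" by simp
  from Suc.IH[OF this] obtain E where E: "orthonormal_fields U k E"
    and *: "\<forall>q\<in>U. \<forall>i\<in>{1..k}. E i q c $ of_nat i > 0 \<and> (\<forall>j\<in>{i<..7}. E i q c $ of_nat j = 0)"
    by (elim exE conjE)
  have tri: "E i q c $ of_nat i > 0" "j \<in> {i<..7} \<Longrightarrow> E i q c $ of_nat j = 0"
    if "q \<in> U" "i \<in> {1..k}" for q i j
    using *[rule_format, OF that] by simp_all
  note Ef = orthonormal_fieldsD(1)[OF E] and Et = orthonormal_fieldsD(2)[OF E] and Eo = orthonormal_fieldsD(3)[OF E]
  define V where "V q = tvec_of c q (axis (of_nat (Suc k)) 1)" for q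
  have V: "vector_field A U V" unfolding V_def by (rule vector_field_tvec_of[OF c])
  define F where "F q = V q - (\<Sum>i\<in>{1..k}. g q (V q) (E i q) *\<^sub>R E i q)" for q
  have F: "vector_field A U F"
    unfolding F_def
    by (rule vector_field_diff[OF c(2) V vector_field_sum[OF c(2) finite_atLeastAtMost
          vector_field_scaleR[OF c(2) g_smooth[OF c(2) V Ef] Ef]]])
  have Fc: "F q c $ of_nat j = (if j = Suc k then 1 else 0)" if "q \<in> U" "j \<in> {Suc k..7}" for q j
  proof -
    have "V q c = axis (of_nat (Suc k)) 1"
      unfolding V_def by (rule tvec_of_self[OF c(1)]) (use c(3) that(1) in blast)
    moreover have "(of_nat j :: 7) = of_nat (Suc k) \<longleftrightarrow> j = Suc k"
      using of_nat_7_inj[of j "Suc k"] that Suc.prems by auto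
    ultimately have 1: "V q c $ of_nat j = (if j = Suc k then 1 else 0)"
      by (simp add: axis_def del: of_nat_Suc)
    have 2: "(\<Sum>i\<in>{1..k}. g q (V q) (E i q) *\<^sub>R E i q) c $ of_nat j = 0"
      unfolding sum_apply sum_component
    proof (rule sum.neutral, intro ballI)
      fix i assume i: "i \<in> {1..k}"
      have "E i q c $ of_nat j = 0" by (rule tri(2)[OF that(1) i]) (use i that(2) in auto)
      then show "(g q (V q) (E i q) *\<^sub>R E i q) c $ of_nat j = 0"
        by (simp add: scaleR_fun_def)
    qed
    have 3: "F q c = V q c - (\<Sum>i\<in>{1..k}. g q (V q) (E i q) *\<^sub>R E i q) c"
      unfolding F_def by (rule fun_diff_def[THEN fun_cong])
    show ?thesis unfolding 3 vector_minus_component 1 2 by (rule diff_zero)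
  qed
  have FE: "g q (F q) (E j q) = 0" if "q \<in> U" "j \<in> {1..k}" for q j
  proof -
    note t = Et[OF that(1)]
    have v: "V q \<in> T q" by (rule vector_field_tangent[OF V \<open>q \<in> U\<close>])
    have s: "(\<Sum>i\<in>{1..k}. g q (V q) (E i q) *\<^sub>R E i q) \<in> T q"
      by (intro subspace_sum[OF tangent_subspace] tangent_closed t)
    have "g q (F q) (E j q) = g q (V q) (E j q) - g q (E j q) (\<Sum>i\<in>{1..k}. g q (V q) (E i q) *\<^sub>R E i q)"
      unfolding F_def g_diff_left[OF t[OF that(2)] v s] g_sym[OF s t[OF that(2)]] ..
    also have "g q (E j q) (\<Sum>i\<in>{1..k}. g q (V q) (E i q) *\<^sub>R E i q) =
        (\<Sum>i\<in>{1..k}. g q (V q) (E i q) * g q (E j q) (E i q))"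
      by (rule linear_form_on_sum[OF tangent_subspace g_linear_form[OF t[OF that(2)]] t])
    also have "\<dots> = (\<Sum>i\<in>{1..k}. if i = j then g q (V q) (E j q) else 0)"
      by (rule sum.cong) (use Eo[OF that] in auto)
    also have "\<dots> = g q (V q) (E j q)" using that(2) by simp
    finally show ?thesis by simp
  qed
  have Fpos: "g q (F q) (F q) > 0" if "q \<in> U" for q
  proof (rule g_pos[OF vector_field_tangent[OF F that]])
    \<comment> \<open>subtracting the earlier frame vectors leaves the leading component untouched\<close>
    have "F q c $ of_nat (Suc k) = 1" using Fc[OF that, of "Suc k"] Suc.prems by simp
    then show "F q \<noteq> 0" by (metis zero_fun_apply zero_index zero_neq_one)
  qed
  \<comment> \<open>\<open>F\<close> is the orthogonal remainder of the next coordinate field, \<open>f\<close> the inverse of its length\<close>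
  define f where "f q = g q (F q) (F q) powr (- 1 / 2)" for q
  have fpos: "f q > 0" if "q \<in> U" for q using Fpos[OF that] by (simp add: f_def)
  have f2: "f q * (f q * g q (F q) (F q)) = 1" if "q \<in> U" for q
  proof -
    have "f q * f q = g q (F q) (F q) powr (- 1)"
      unfolding f_def powr_add[symmetric] by simp
    then show ?thesis using Fpos[OF that] by (simp add: powr_minus mult.assoc[symmetric])
  qed
  define N where "N q = f q *\<^sub>R F q" for q
  have N: "vector_field A U N"
    unfolding N_def f_def
    by (rule vector_field_scaleR[OF c(2) smooth_fun_powr[OF c(2) g_smooth[OF c(2) F F]] F]) (rule Fpos)
  have NN: "g q (N q) (N q) = 1" if "q \<in> U" for q
  proof -
    have t: "F q \<in> T q" by (rule vector_field_tangent[OF F that])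
    show ?thesis unfolding N_def g_scale_left[OF tangent_closed(3)[OF t] t] g_scale_right[OF t t]
      by (rule f2[OF that])
  qed
  have NE: "g q (N q) (E j q) = 0" "g q (E j q) (N q) = 0" if "q \<in> U" "j \<in> {1..k}" for q j
  proof -
    have t: "F q \<in> T q" "E j q \<in> T q" "N q \<in> T q"
      by (rule vector_field_tangent[OF F that(1)] Et[OF that] vector_field_tangent[OF N that(1)])+
    show "g q (N q) (E j q) = 0" unfolding N_def g_scale_left[OF t(2,1)] FE[OF that] by simp
    then show "g q (E j q) (N q) = 0" using g_sym[OF t(2,3)] by simp
  qed
  define E' where "E' = E(Suc k := N)"
  have "orthonormal_fields U (Suc k) E'"
    unfolding orthonormal_fields_def
  proof (intro conjI ballI)
    show "vector_field A U (E' i)" if "i \<in> {1..Suc k}" for i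
      using that N Ef[of i] by (auto simp: E'_def)
    fix q i j assume "q \<in> U" "i \<in> {1..Suc k}" "j \<in> {1..Suc k}"
    then show "g q (E' i q) (E' j q) = (if i = j then 1 else 0)"
      using NN[of q] NE[of q i] NE[of q j] Eo[of q i j]
      by (cases "i = Suc k"; cases "j = Suc k") (auto simp: E'_def)
  qed
  moreover have "E' i q c $ of_nat i > 0 \<and> (\<forall>j\<in>{i<..7}. E' i q c $ of_nat j = 0)"
    if q: "q \<in> U" and "i \<in> {1..Suc k}" for q i
  proof (cases "i = Suc k")
    case True
    have "E' i q c $ of_nat j = f q * F q c $ of_nat j" for j
      by (simp add: True E'_def N_def scaleR_fun_def del: of_nat_Suc)
    then show ?thesis using Fc[OF q] fpos[OF q] True Suc.prems by (simp del: of_nat_Suc)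
  next
    case False
    then have "i \<in> {1..k}" using that by auto
    then show ?thesis using tri[OF q] False by (auto simp: E'_def)
  qed
  ultimately show ?case by blast
qed

text \<open>Seven orthonormal vectors span; the dimension count is done in the model \<open>\<real>\<^sup>7\<close>.\<close>

lemma orthonormal_fields_expand:
  assumes "orthonormal_fields U 7 E" "q \<in> U" "v \<in> T q"
  shows "v = (\<Sum>i\<in>{1..7}. g q v (E i q) *\<^sub>R E i q)"
proof -
  obtain L where L: "G2_iso q L" using ex_G2_iso by blast
  have "\<forall>i\<in>{1..7}. \<exists>y. E i q = L y"
    using G2_iso_surj[OF L orthonormal_fieldsD(2)[OF assms(1,2)]] by blast
  from bchoice[OF this] obtain x where x: "\<And>i. i \<in> {1..7} \<Longrightarrow> E i q = L (x i)" by blast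
  obtain y where y: "v = L y" using G2_iso_surj[OF L assms(3)] by blast
  have xx: "x i \<bullet> x j = (if i = j then 1 else 0)" if "i \<in> {1..7}" "j \<in> {1..7}" for i j
    using orthonormal_fieldsD(3)[OF assms(1,2) that]
    unfolding x[OF that(1)] x[OF that(2)] G2_isoD(4)[OF L] .
  have inj: "inj_on x {1..7}"
    by (rule inj_onI) (use xx in \<open>metis zero_neq_one\<close>)
  have 0: "0 \<notin> x ` {1..7}"
    using xx by force
  have "independent (x ` {1..7})"
    by (rule pairwise_orthogonal_independent[OF _ 0])
      (use xx in \<open>auto simp: pairwise_def orthogonal_def\<close>)
  then have "span (x ` {1..7}) = UNIV"
    using card_image[OF inj] card_ge_dim_independent[of "x ` {1..7}" UNIV] by (auto simp: DIM_cart)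
  then have "y \<in> span (x ` {1..7})" by blast
  then have "(\<Sum>b\<in>x ` {1..7}. (y \<bullet> b) *\<^sub>R b) = y"
    by (intro orthonormal_basis_expand) (use xx in \<open>auto simp: pairwise_def orthogonal_def norm_eq_1\<close>)
  then have "y = (\<Sum>i\<in>{1..7}. (y \<bullet> x i) *\<^sub>R x i)"
    unfolding sum.reindex[OF inj] o_def by (rule sym)
  then have "v = L (\<Sum>i\<in>{1..7}. (y \<bullet> x i) *\<^sub>R x i)" using y by simp
  also have "\<dots> = (\<Sum>i\<in>{1..7}. (y \<bullet> x i) *\<^sub>R L (x i))"
    by (simp only: linear_sum[OF G2_isoD(1)[OF L]] linear_scale[OF G2_isoD(1)[OF L]])
  also have "\<dots> = (\<Sum>i\<in>{1..7}. g q v (E i q) *\<^sub>R E i q)"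
    by (rule sum.cong[OF refl]) (simp only: x y G2_isoD(4)[OF L])
  finally show ?thesis .
qed

text \<open>Cross products are defined pointwise by duality. In an orthonormal frame the dual vector is given by
  values of \<open>\<phi>\<close>, so it depends smoothly on the point.\<close>

lemma vector_field_cross:
  assumes U: "open U" and E: "orthonormal_fields U 7 E" and VW: "vector_field A U V" "vector_field A U W"
  shows "vector_field A U (\<lambda>q. cr q (V q) (W q))"
proof -
  note Ef = orthonormal_fieldsD(1)[OF E]
  have "vector_field A U (\<lambda>q. \<Sum>i\<in>{1..7}. \<phi> q (E i q) (V q) (W q) *\<^sub>R E i q)"
    by (rule vector_field_sum[OF U finite_atLeastAtMost vector_field_scaleR[OF U phi_smooth[OF U Ef VW] Ef]])
  moreover have "cr q (V q) (W q) = (\<Sum>i\<in>{1..7}. \<phi> q (E i q) (V q) (W q) *\<^sub>R E i q)" if "q \<in> U" for q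
  proof -
    have t: "V q \<in> T q" "W q \<in> T q" "\<And>i. i \<in> {1..7} \<Longrightarrow> E i q \<in> T q"
      by (rule vector_field_tangent[OF VW(1) that] vector_field_tangent[OF VW(2) that]
          orthonormal_fieldsD(2)[OF E that], assumption?)+
    have "cr q (V q) (W q) = (\<Sum>i\<in>{1..7}. g q (cr q (V q) (W q)) (E i q) *\<^sub>R E i q)"
      by (rule orthonormal_fields_expand[OF E that cross_tangent[OF t(1,2)]])
    also have "\<dots> = (\<Sum>i\<in>{1..7}. \<phi> q (E i q) (V q) (W q) *\<^sub>R E i q)"
      by (rule sum.cong[OF refl]) (simp only: g_sym[OF cross_tangent[OF t(1,2)] t(3)] g_cross[OF t(3,1,2)])
    finally show ?thesis .
  qed
  ultimately show ?thesis by (rule vector_field_cong[OF U, rotated])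
qed

end

section \<open>Differentiation along the surface\<close>

abbreviation in_plane :: "real ^ 7 \<Rightarrow> bool" where
  "in_plane x \<equiv> \<forall>i. i \<noteq> 1 \<and> i \<noteq> 2 \<longrightarrow> x $ i = 0"

lemma derivative_along_plane:
  fixes F :: "real ^ 7 \<Rightarrow> real"
  assumes F: "(F has_derivative L) (at x)" and G: "open G" "x \<in> G"
    and const: "\<And>y. y \<in> G \<Longrightarrow> in_plane y \<Longrightarrow> F y = k"
    and x: "in_plane x" and v: "in_plane v"
  shows "L v = 0"
proof -
  let ?r = "\<lambda>t::real. x + t *\<^sub>R v"
  have "(?r has_derivative (\<lambda>t. t *\<^sub>R v)) (at 0)"
    by (auto intro!: derivative_eq_intros)
  moreover have "(F has_derivative L) (at (?r 0))" using F by simp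
  ultimately have 1: "((\<lambda>t. F (?r t)) has_derivative (\<lambda>t. L (t *\<^sub>R v))) (at 0)"
    by (rule has_derivative_compose)
  have "open (?r -` G)" by (intro open_vimage G continuous_intros)
  moreover have "F (?r t) = k" if "t \<in> ?r -` G" for t
    by (rule const) (use that x v in auto)
  ultimately have "((\<lambda>t. k) has_derivative (\<lambda>t. L (t *\<^sub>R v))) (at 0)"
    by (intro has_derivative_transform_within_open[OF 1, of "?r -` G"]) (use G in auto)
  then have "(\<lambda>t. L (t *\<^sub>R v)) = (\<lambda>t. 0)"
    by (rule has_derivative_unique) (rule has_derivative_const)
  from fun_cong[OF this, of 1] show ?thesis by simp
qed

text \<open>By the Lagrange identity the square of the determinant is 1.\<close>

lemma orthonormal_coeffs_det_1:
  fixes \<alpha> \<beta> \<gamma> \<delta> :: real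
  assumes "\<alpha> * \<alpha> + \<beta> * \<beta> = 1" "\<gamma> * \<gamma> + \<delta> * \<delta> = 1" "\<alpha> * \<gamma> + \<beta> * \<delta> = 0" "\<alpha> * \<delta> - \<beta> * \<gamma> > 0"
  shows "\<alpha> * \<delta> - \<beta> * \<gamma> = 1"
proof -
  have "(\<alpha> * \<delta> - \<beta> * \<gamma>)\<^sup>2 + (\<alpha> * \<gamma> + \<beta> * \<delta>)\<^sup>2 = (\<alpha> * \<alpha> + \<beta> * \<beta>) * (\<gamma> * \<gamma> + \<delta> * \<delta>)"
    by (simp add: power2_eq_square algebra_simps)
  then have "(\<alpha> * \<delta> - \<beta> * \<gamma>)\<^sup>2 = 1" using assms by simp
  then show ?thesis using assms(4) by (simp add: power2_eq_1_iff)
qed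

locale G2_surface = G2 A \<phi> g D
  for A :: "('a::{t2_space, second_countable_topology}, 7) chart set"
    and \<phi> :: "'a \<Rightarrow> ('a, 7) tvec \<Rightarrow> ('a, 7) tvec \<Rightarrow> ('a, 7) tvec \<Rightarrow> real"
    and g :: "'a \<Rightarrow> ('a, 7) tvec \<Rightarrow> ('a, 7) tvec \<Rightarrow> real"
    and D :: "('a, 7) connection" +
  fixes \<Sigma> :: "'a set"
    and Or :: "'a orientation"
  assumes surf: "surface A \<Sigma>"
    and ori: "orientation A \<Sigma> Or"
begin

abbreviation TS where "TS \<equiv> surface_tangent A \<Sigma>"
abbreviation \<eta> where "\<eta> \<equiv> unit_normal A \<phi> g Or"
abbreviation W where "W \<equiv> W_fibre A \<phi> g \<Sigma> Or"
abbreviation J where "J \<equiv> J_W A \<phi> g Or"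

lemma slice_chartD:
  assumes "slice_chart A \<Sigma> c"
  shows "c \<in> A" and "q \<in> fst c \<Longrightarrow> q \<in> \<Sigma> \<longleftrightarrow> in_plane (snd c q)"
proof -
  show "c \<in> A" by (rule assms[unfolded slice_chart_def, THEN conjunct1])
  have "\<Sigma> \<inter> fst c = {q \<in> fst c. in_plane (snd c q)}"
    by (rule assms[unfolded slice_chart_def, THEN conjunct2])
  then show "q \<in> fst c \<Longrightarrow> q \<in> \<Sigma> \<longleftrightarrow> in_plane (snd c q)" by blast
qed

text \<open>In a slice chart the surface is a coordinate plane, so a function that is constant on the surface has
  no derivative along this plane.\<close>

lemma derivative_along_surface:
  fixes F :: "'a \<Rightarrow> real"
  assumes c: "slice_chart A \<Sigma> c" and p: "p \<in> fst c" "p \<in> \<Sigma>" "p \<in> U" "open U"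
    and F: "((\<lambda>x. F (chart_inv c x)) has_derivative L) (at (snd c p))"
    and const: "\<And>q. q \<in> \<Sigma> \<inter> U \<Longrightarrow> F q = k" and v: "in_plane v"
  shows "L v = 0"
proof (rule derivative_along_plane[OF F chart_image_open[OF slice_chartD(1)[OF c] p(4)]])
  show "snd c p \<in> snd c ` (fst c \<inter> U)" using p by blast
  show "in_plane (snd c p)" using slice_chartD(2)[OF c p(1)] p(2) by blast
  show "F (chart_inv c y) = k" if y: "y \<in> snd c ` (fst c \<inter> U)" "in_plane y" for y
  proof -
    obtain q where q: "q \<in> fst c" "q \<in> U" "y = snd c q" using y(1) by blast
    have "q \<in> \<Sigma>" using slice_chartD(2)[OF c q(1)] y(2) unfolding q(3) by blast
    then show ?thesis unfolding q(3) chart_inv[OF slice_chartD(1)[OF c] q(1)] using const q(2) by blast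
  qed
qed (rule v)

text \<open>The tangent space of the surface can be tested in any one slice chart: the remaining coordinates of
  this chart vanish on the surface, so their derivatives along tangent vectors, taken in another slice
  chart, vanish as well.\<close>

lemma TS_chart:
  assumes c: "slice_chart A \<Sigma> c" and p: "p \<in> fst c" "p \<in> \<Sigma>"
  shows "v \<in> TS p \<longleftrightarrow> v \<in> T p \<and> in_plane (v c)"
proof
  assume "v \<in> T p \<and> in_plane (v c)"
  then show "v \<in> TS p" unfolding surface_tangent_def using c p by blast
next
  assume "v \<in> TS p"
  then obtain d where v: "v \<in> T p" and d: "slice_chart A \<Sigma> d" "p \<in> fst d" "in_plane (v d)"
    unfolding surface_tangent_def by blast
  note cA = slice_chartD(1)[OF c] and dA = slice_chartD(1)[OF d(1)]
  have "v c $ i = 0" if i: "i \<noteq> 1 \<and> i \<noteq> 2" for i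
  proof -
    have D1: "((\<lambda>x. snd c (chart_inv d x) $ i) has_derivative (\<lambda>v. jac d c p v $ i)) (at (snd d p))"
      by (rule bounded_linear.has_derivative[OF bounded_linear_vec_nth
            has_frechet[OF transition_differentiable[OF dA cA d(2) p(1)], unfolded o_def], folded o_def])
    have D2: "snd c q $ i = 0" if "q \<in> \<Sigma> \<inter> fst c" for q
      using slice_chartD(2)[OF c, of q] that i by blast
    have "jac d c p (v d) $ i = 0"
      by (rule derivative_along_surface[OF d(1,2) p(2,1) chart_open[OF cA] D1 D2 d(3)])
    then show ?thesis unfolding tangent_comp[OF v dA d(2) cA p(1)] .
  qed
  then show "v \<in> T p \<and> in_plane (v c)" using v by blast
qed

lemma TS_tangent: "v \<in> TS p \<Longrightarrow> v \<in> T p"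
  unfolding surface_tangent_def by blast

lemma ex_slice_chart: "p \<in> \<Sigma> \<Longrightarrow> \<exists>c. slice_chart A \<Sigma> c \<and> p \<in> fst c"
  using surf unfolding surface_def by (rule bspec)

lemma dir_deriv_agree:
  assumes f: "smooth_fun A U f" "smooth_fun A U h" and U: "open U" "p \<in> U" and p: "p \<in> \<Sigma>"
    and v: "v \<in> TS p" and eq: "\<And>q. q \<in> \<Sigma> \<inter> U \<Longrightarrow> f q = h q"
  shows "dir_deriv A p v f = dir_deriv A p v h"
proof -
  obtain c where c: "slice_chart A \<Sigma> c" "p \<in> fst c" using ex_slice_chart[OF p] by blast
  note cA = slice_chartD(1)[OF c(1)]
  have D1: "((\<lambda>x. f (chart_inv c x) - h (chart_inv c x)) has_derivative
    (\<lambda>v. frechet_derivative (\<lambda>x. f (chart_inv c x)) (at (snd c p)) v -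
         frechet_derivative (\<lambda>x. h (chart_inv c x)) (at (snd c p)) v)) (at (snd c p))"
    by (rule has_derivative_diff[OF has_frechet has_frechet])
      (rule smooth_fun_differentiable[OF f(1) U(2) cA c(2)] smooth_fun_differentiable[OF f(2) U(2) cA c(2)])+
  have D2: "f q - h q = 0" if "q \<in> \<Sigma> \<inter> U" for q using eq[OF that] by simp
  have D3: "in_plane (v c)" using TS_chart[OF c p] v by blast
  have "frechet_derivative (\<lambda>x. f (chart_inv c x)) (at (snd c p)) (v c) -
         frechet_derivative (\<lambda>x. h (chart_inv c x)) (at (snd c p)) (v c) = 0"
    by (rule derivative_along_surface[where F="\<lambda>q. f q - h q", OF c p U(2,1) D1 D2 D3])
  then show ?thesis
    unfolding dir_deriv_chart[OF f(1) U(2) TS_tangent[OF v] cA c(2)] dir_deriv_chart[OF f(2) U(2) TS_tangent[OF v] cA c(2)]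
    by simp
qed

lemma ex_vector_field:
  assumes "z \<in> T p" "p \<in> U" "open U"
  shows "\<exists>U' Z. open U' \<and> p \<in> U' \<and> U' \<subseteq> U \<and> vector_field A U' Z \<and> Z p = z"
proof -
  obtain c where c: "c \<in> A" "p \<in> fst c" using ex_chart by blast
  have "vector_field A (fst c \<inter> U) (\<lambda>q. tvec_of c q (z c))"
    by (rule vector_field_tvec_of[OF c(1)]) (use chart_open[OF c(1)] assms(3) in auto)
  moreover have "tvec_of c p (z c) = z" by (rule tvec_of_comp[OF c assms(1)])
  ultimately show ?thesis using assms c open_Int[OF chart_open[OF c(1)] assms(3)]
    by (intro exI[of _ "fst c \<inter> U"] exI[of _ "\<lambda>q. tvec_of c q (z c)"]) blast
qed

lemma extends_nearD:
  assumes "extends_near A \<Sigma> p s S"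
  obtains U where "open U" "p \<in> U" "vector_field A U S" "\<And>q. q \<in> \<Sigma> \<inter> U \<Longrightarrow> S q = s q"
  using assms unfolding extends_near_def by blast

lemma extends_nearI:
  "open U \<Longrightarrow> p \<in> U \<Longrightarrow> vector_field A U S \<Longrightarrow> (\<And>q. q \<in> \<Sigma> \<inter> U \<Longrightarrow> S q = s q) \<Longrightarrow> extends_near A \<Sigma> p s S"
  unfolding extends_near_def by blast

text \<open>Pair the two extensions with a vector field \<open>Z\<close>. The resulting functions agree on the surface, so they
  have the same tangential derivative, and by metric compatibility the values of the two covariant
  derivatives against \<open>Z\<close> agree. Choosing \<open>Z\<close> to extend their difference finishes the proof.\<close>

lemma D_extension_unique:
  assumes p: "p \<in> \<Sigma>" and v: "v \<in> TS p" and S: "extends_near A \<Sigma> p s S" and R: "extends_near A \<Sigma> p s R"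
  shows "D p v S = D p v R"
proof -
  obtain U1 where U1: "open U1" "p \<in> U1" "vector_field A U1 S" "\<And>q. q \<in> \<Sigma> \<inter> U1 \<Longrightarrow> S q = s q"
    by (rule extends_nearD[OF S]) (rule that)
  obtain U2 where U2: "open U2" "p \<in> U2" "vector_field A U2 R" "\<And>q. q \<in> \<Sigma> \<inter> U2 \<Longrightarrow> R q = s q"
    by (rule extends_nearD[OF R]) (rule that)
  note vT = TS_tangent[OF v]
  have DT: "D p v S \<in> T p" "D p v R \<in> T p" by (rule D_tangent[OF U1(1,3,2) vT] D_tangent[OF U2(1,3,2) vT])+
  define z where "z = D p v S - D p v R"
  have z: "z \<in> T p" unfolding z_def by (rule tangent_closed(2)[OF DT])
  obtain U Z where U: "open U" "p \<in> U" "U \<subseteq> U1 \<inter> U2" and Z: "vector_field A U Z" and Zp: "Z p = z"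
    using ex_vector_field[OF z, of "U1 \<inter> U2"] U1(1,2) U2(1,2) open_Int by blast
  have SR: "vector_field A U S" "vector_field A U R"
    by (rule vector_field_subset[OF U1(3)] vector_field_subset[OF U2(3)], use U(3) in blast)+
  have eq: "S q = R q" if "q \<in> \<Sigma> \<inter> U" for q
  proof -
    have "q \<in> \<Sigma> \<inter> U1" "q \<in> \<Sigma> \<inter> U2" using that U(3) by blast+
    then show ?thesis by (simp only: U1(4) U2(4))
  qed
  have "dir_deriv A p v (\<lambda>q. g q (S q) (Z q)) = dir_deriv A p v (\<lambda>q. g q (R q) (Z q))"
    by (rule dir_deriv_agree[OF g_smooth[OF U(1) SR(1) Z] g_smooth[OF U(1) SR(2) Z] U(1,2) p v])
      (simp only: eq)
  then have "g p (D p v S) z = g p (D p v R) z"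
    unfolding D_metric[OF U(1) SR(1) Z U(2) vT] D_metric[OF U(1) SR(2) Z U(2) vT] Zp
    using eq[of p] p U(2) by simp
  then have "g p z z = 0" using g_diff_left[OF z DT] by (simp add: z_def)
  then have "z = 0" using g_pos[OF z] by force
  then show ?thesis by (simp add: z_def)
qed

lemma nabla_X_eq:
  assumes "p \<in> \<Sigma>" "v \<in> TS p" "extends_near A \<Sigma> p s S"
  shows "nabla_X A D \<Sigma> p v s = D p v S"
  unfolding nabla_X_def
  by (rule D_extension_unique[OF assms(1,2) someI[of "extends_near A \<Sigma> p s", OF assms(3)] assms(3)])

section \<open>The unit normal field and the fibres of W\<close>

definition adapted :: "'a \<Rightarrow> ('a, 7) tvec \<Rightarrow> ('a, 7) tvec \<Rightarrow> bool" where
  "adapted q a b \<longleftrightarrow> a \<in> T q \<and> b \<in> T q \<and> g q a a = 1 \<and> g q b b = 1 \<and> g q a b = 0 \<and>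
     TS q = {\<alpha> *\<^sub>R a + \<beta> *\<^sub>R b | \<alpha> \<beta>. True} \<and> \<eta> q = cr q a b"

text \<open>The first two vectors of the Gram-Schmidt frame of an oriented slice chart. That \<open>\<eta>\<close> is their cross
  product requires that the cross product is the same for all oriented orthonormal bases of the
  tangent plane, that is, that the transition matrix has determinant one.\<close>

lemma adapted_frame:
  assumes p: "p \<in> \<Sigma>"
  shows "\<exists>U E. open U \<and> p \<in> U \<and> orthonormal_fields U 7 E \<and> (\<forall>q\<in>\<Sigma> \<inter> U. adapted q (E 1 q) (E 2 q))"
proof -
  obtain c where c: "slice_chart A \<Sigma> c" "p \<in> fst c" and
    Or: "\<And>q. q \<in> \<Sigma> \<inter> fst c \<Longrightarrow> Or q =
        {(u, v). u \<in> TS q \<and> v \<in> TS q \<and> u c $ 1 * v c $ 2 - u c $ 2 * v c $ 1 > 0}"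
    using ori[unfolded orientation_def, THEN bspec, OF p] by blast
  note cA = slice_chartD(1)[OF c(1)]
  obtain E where E: "orthonormal_fields (fst c) 7 E" and
    tri: "\<forall>q\<in>fst c. \<forall>i\<in>{1..7}. E i q c $ of_nat i > 0 \<and> (\<forall>j\<in>{i<..7}. E i q c $ of_nat j = 0)"
    using gram_schmidt[OF cA chart_open[OF cA] order_refl order_refl] by blast
  have "adapted q (E 1 q) (E 2 q)" if q: "q \<in> \<Sigma>" "q \<in> fst c" for q
  proof -
    define a b where "a = E 1 q" and "b = E 2 q"
    have aT: "a \<in> T q" and bT: "b \<in> T q"
      unfolding a_def b_def by (rule orthonormal_fieldsD(2)[OF E q(2)], simp)+
    have on: "g q a a = 1" "g q b b = 1" "g q a b = 0"
      unfolding a_def b_def by (subst orthonormal_fieldsD(3)[OF E q(2)]; simp)+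
    have pos: "a c $ 1 > 0" "b c $ 2 > 0"
      using tri[rule_format, OF q(2), of 1] tri[rule_format, OF q(2), of 2] by (simp_all add: a_def b_def)
    have a0: "a c $ of_nat j = 0" if "j \<in> {2..7}" for j
      using tri[rule_format, OF q(2), of 1, THEN conjunct2, rule_format, of j] that by (simp add: a_def)
    have b0: "b c $ of_nat j = 0" if "j \<in> {3..7}" for j
      using tri[rule_format, OF q(2), of 2, THEN conjunct2, rule_format, of j] that by (simp add: b_def)
    have plane: "in_plane (a c)" "in_plane (b c)"
      using a0[of 3] a0[of 4] a0[of 5] a0[of 6] a0[of 7] b0[of 3] b0[of 4] b0[of 5] b0[of 6] b0[of 7]
      by (simp_all add: forall_7)
    have a2: "a c $ 2 = 0" using a0[of 2] by simp
    note TSc = TS_chart[OF c(1) q(2,1)]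
    have comp: "(\<alpha> *\<^sub>R a + \<beta> *\<^sub>R b) c = \<alpha> *\<^sub>R a c + \<beta> *\<^sub>R b c" for \<alpha> \<beta>
      unfolding plus_fun_apply scaleR_fun_def ..
    have ab: "\<alpha> *\<^sub>R a + \<beta> *\<^sub>R b \<in> T q" for \<alpha> \<beta>
      by (intro tangent_closed(1,3) aT bT)
    have 1: "\<exists>\<alpha> \<beta>. w = \<alpha> *\<^sub>R a + \<beta> *\<^sub>R b" if w: "w \<in> TS q" for w
    proof -
      \<comment> \<open>back substitution: the second component of \<open>a\<close> is zero\<close>
      define \<beta> where "\<beta> = w c $ 2 / b c $ 2"
      define \<alpha> where "\<alpha> = (w c $ 1 - \<beta> * b c $ 1) / a c $ 1"
      have "w c $ i = (\<alpha> *\<^sub>R a c + \<beta> *\<^sub>R b c) $ i" for i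
      proof (cases "i = 1 \<or> i = 2")
        case True
        then show ?thesis using a2 pos by (auto simp: \<alpha>_def \<beta>_def)
      next
        case False
        then show ?thesis using TSc[of w] w plane by auto
      qed
      then have "w c = (\<alpha> *\<^sub>R a + \<beta> *\<^sub>R b) c" unfolding comp vec_eq_iff by blast
      then have "w = \<alpha> *\<^sub>R a + \<beta> *\<^sub>R b"
        by (rule tangent_eqI[OF TS_tangent[OF w] ab cA q(2)])
      then show ?thesis by blast
    qed
    have 2: "\<alpha> *\<^sub>R a + \<beta> *\<^sub>R b \<in> TS q" for \<alpha> \<beta>
      unfolding TSc comp using ab plane by simp
    have TSab: "TS q = {\<alpha> *\<^sub>R a + \<beta> *\<^sub>R b | \<alpha> \<beta>. True}" using 1 2 by blast
    have aTS: "a \<in> TS q" "b \<in> TS q" using 2[of 1 0] 2[of 0 1] by simp_all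
    have "\<eta> q = cr q a b"
      unfolding unit_normal_def
    proof (rule the_equality)
      show "\<forall>u v. (u, v) \<in> Or q \<and> g q u u = 1 \<and> g q v v = 1 \<and> g q u v = 0 \<longrightarrow> cr q a b = cr q u v"
      proof (intro allI impI)
        fix u v assume uv: "(u, v) \<in> Or q \<and> g q u u = 1 \<and> g q v v = 1 \<and> g q u v = 0"
        have uvTS: "u \<in> TS q" "v \<in> TS q" and det: "u c $ 1 * v c $ 2 - u c $ 2 * v c $ 1 > 0"
          using uv Or[of q] q by auto
        obtain \<alpha> \<beta> where u: "u = \<alpha> *\<^sub>R a + \<beta> *\<^sub>R b" using 1[OF uvTS(1)] by blast
        obtain \<gamma> \<delta> where v: "v = \<gamma> *\<^sub>R a + \<delta> *\<^sub>R b" using 1[OF uvTS(2)] by blast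
        obtain L where L: "G2_iso q L" using ex_G2_iso by blast
        obtain x y where x: "a = L x" and y: "b = L y"
          using G2_iso_surj[OF L aT] G2_iso_surj[OF L bT] by blast
        have xy: "x \<bullet> x = 1" "y \<bullet> y = 1" "x \<bullet> y = 0" using on unfolding x y G2_isoD(4)[OF L] .
        have u': "u = L (\<alpha> *\<^sub>R x + \<beta> *\<^sub>R y)" and v': "v = L (\<gamma> *\<^sub>R x + \<delta> *\<^sub>R y)"
          unfolding u v x y linear_add[OF G2_isoD(1)[OF L]] linear_scale[OF G2_isoD(1)[OF L]] by (rule refl)+
        have "\<alpha> * \<alpha> + \<beta> * \<beta> = 1" "\<gamma> * \<gamma> + \<delta> * \<delta> = 1" "\<alpha> * \<gamma> + \<beta> * \<delta> = 0"
          using uv[THEN conjunct2] unfolding u' v' G2_isoD(4)[OF L]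
          by (simp_all add: inner_left_distrib inner_right_distrib xy inner_commute[of y x] mult.commute)
        moreover have "(\<alpha> * \<delta> - \<beta> * \<gamma>) * (a c $ 1 * b c $ 2) > 0"
          using det unfolding u v comp by (simp add: a2 algebra_simps)
        then have "\<alpha> * \<delta> - \<beta> * \<gamma> > 0" using mult_pos_pos[OF pos] by (rule zero_less_mult_pos2)
        ultimately have "\<alpha> * \<delta> - \<beta> * \<gamma> = 1" by (rule orthonormal_coeffs_det_1)
        moreover have "cross0 x x = 0" for x by (simp add: cross0_def phi0_repeat vec_eq_iff)
        then have "cross0 (\<alpha> *\<^sub>R x + \<beta> *\<^sub>R y) (\<gamma> *\<^sub>R x + \<delta> *\<^sub>R y) = (\<alpha> * \<delta> - \<beta> * \<gamma>) *\<^sub>R cross0 x y"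
          using cross0_swap[of y x] by (simp add: cross0_simps algebra_simps)
        ultimately show "cr q a b = cr q u v"
          unfolding u' v' x y cross_iso[OF L] by simp
      qed
    next
      fix m assume "\<forall>u v. (u, v) \<in> Or q \<and> g q u u = 1 \<and> g q v v = 1 \<and> g q u v = 0 \<longrightarrow> m = cr q u v"
      moreover have "(a, b) \<in> Or q" using Or[of q] q aTS a2 pos by simp
      ultimately show "m = cr q a b" using on by blast
    qed
    then show ?thesis unfolding adapted_def a_def[symmetric] b_def[symmetric] using aT bT on TSab by blast
  qed
  then show ?thesis using chart_open[OF cA] c(2) E
    by (intro exI[of _ "fst c"] exI[of _ E]) blast
qed

text \<open>Two candidates for the projection differ by a vector of \<open>E\<close> that is orthogonal to \<open>E\<close>, so guessing
  the projection is enough to identify it.\<close>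

lemma orth_proj_eqI:
  assumes E: "subspace E" "E \<subseteq> T q" and z: "z \<in> T q" and w: "w \<in> E" "\<And>e. e \<in> E \<Longrightarrow> g q (z - w) e = 0"
  shows "orth_proj (g q) E z = w"
  unfolding orth_proj_def
proof (rule the_equality)
  show "w \<in> E \<and> (\<forall>e\<in>E. g q (z - w) e = 0)" using w by blast
next
  fix y assume y: "y \<in> E \<and> (\<forall>e\<in>E. g q (z - y) e = 0)"
  have e: "w - y \<in> E" by (rule subspace_diff[OF E(1) w(1) y[THEN conjunct1]])
  have m: "w \<in> T q" "y \<in> T q" "w - y \<in> T q" using e w y E(2) by blast+
  have "g q z (w - y) - g q w (w - y) = 0" "g q z (w - y) - g q y (w - y) = 0"
    using w(2)[OF e] y[THEN conjunct2, rule_format, OF e] g_diff_left[OF m(3) z m(1)] g_diff_left[OF m(3) z m(2)]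
    by simp_all
  then have "g q (w - y) (w - y) = 0" using g_diff_left[OF m(3) m(1,2)] by simp
  then have "w - y = 0" using g_pos[OF m(3)] by force
  then show "y = w" by simp
qed

text \<open>Coordinates of the tangent space at a point of the surface in which the tangent plane, the unit normal
  and the fibre of \<open>W\<close> take the form of the model \<open>orthonormal_pair\<close>.\<close>

definition fibre_model :: "'a \<Rightarrow> (real ^ 7 \<Rightarrow> ('a, 7) tvec) \<Rightarrow> real ^ 7 \<Rightarrow> real ^ 7 \<Rightarrow> bool" where
  "fibre_model q L u v \<longleftrightarrow> G2_iso q L \<and> orthonormal_pair u v \<and> \<eta> q = L (cross0 u v) \<and>
     TS q = {L (\<alpha> *\<^sub>R u + \<beta> *\<^sub>R v) | \<alpha> \<beta>. True} \<and> (\<forall>x. L x \<in> W q \<longleftrightarrow> x \<in> orthonormal_pair.W0 u v)"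

lemma fibre_modelD:
  assumes "fibre_model q L u v"
  shows "G2_iso q L" "orthonormal_pair u v" "\<eta> q = L (cross0 u v)" "TS q = {L (\<alpha> *\<^sub>R u + \<beta> *\<^sub>R v) | \<alpha> \<beta>. True}"
    "L x \<in> W q \<longleftrightarrow> x \<in> orthonormal_pair.W0 u v" "J q (L x) = L (cross0 (cross0 u v) x)"
proof -
  show 1: "G2_iso q L" and "orthonormal_pair u v" and 3: "\<eta> q = L (cross0 u v)"
    and "TS q = {L (\<alpha> *\<^sub>R u + \<beta> *\<^sub>R v) | \<alpha> \<beta>. True}" and "L x \<in> W q \<longleftrightarrow> x \<in> orthonormal_pair.W0 u v"
    using assms unfolding fibre_model_def by blast+
  show "J q (L x) = L (cross0 (cross0 u v) x)" unfolding J_W_def 3 by (rule cross_iso[OF 1])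
qed

lemma W_tangent: "w \<in> W q \<Longrightarrow> w \<in> T q"
  unfolding W_fibre_def by blast

lemma ex_fibre_model:
  assumes "q \<in> \<Sigma>"
  shows "\<exists>L u v. fibre_model q L u v"
proof -
  obtain a b where "adapted q a b" using adapted_frame[OF assms] assms by blast
  then have aT: "a \<in> T q" and bT: "b \<in> T q" and on: "g q a a = 1" "g q b b = 1" "g q a b = 0"
    and TSab: "TS q = {\<alpha> *\<^sub>R a + \<beta> *\<^sub>R b | \<alpha> \<beta>. True}" and n: "\<eta> q = cr q a b"
    unfolding adapted_def by blast+
  obtain L where L: "G2_iso q L" using ex_G2_iso by blast
  obtain u v where u: "a = L u" and v: "b = L v"
    using G2_iso_surj[OF L aT] G2_iso_surj[OF L bT] by blast
  have uv: "u \<bullet> u = 1" "v \<bullet> v = 1" "u \<bullet> v = 0" using on unfolding u v G2_isoD(4)[OF L] .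
  interpret orthonormal_pair u v by unfold_locales (rule uv)+
  have n': "\<eta> q = L n" unfolding n u v by (rule cross_iso[OF L])
  have TS': "TS q = {L (\<alpha> *\<^sub>R u + \<beta> *\<^sub>R v) | \<alpha> \<beta>. True}"
    unfolding TSab u v linear_add[OF G2_isoD(1)[OF L]] linear_scale[OF G2_isoD(1)[OF L]] ..
  have "L x \<in> W q \<longleftrightarrow> x \<in> W0" for x
  proof -
    have "(\<forall>t\<in>TS q. g q (L x) t = 0) \<longleftrightarrow> (\<forall>\<alpha> \<beta>. x \<bullet> (\<alpha> *\<^sub>R u + \<beta> *\<^sub>R v) = 0)"
      unfolding TS' G2_isoD(4)[OF L, symmetric] by blast
    then have "L x \<in> W q \<longleftrightarrow> (\<forall>\<alpha> \<beta>. x \<bullet> (\<alpha> *\<^sub>R u + \<beta> *\<^sub>R v) = 0) \<and> x \<bullet> n = 0"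
      unfolding W_fibre_def n' G2_isoD(4)[OF L, symmetric] using G2_isoD(3)[OF L] by simp
    also have "(\<forall>\<alpha> \<beta>. x \<bullet> (\<alpha> *\<^sub>R u + \<beta> *\<^sub>R v) = 0) \<longleftrightarrow> x \<bullet> u = 0 \<and> x \<bullet> v = 0"
    proof
      assume *: "\<forall>\<alpha> \<beta>. x \<bullet> (\<alpha> *\<^sub>R u + \<beta> *\<^sub>R v) = 0"
      show "x \<bullet> u = 0 \<and> x \<bullet> v = 0" using *[rule_format, of 1 0] *[rule_format, of 0 1] by simp
    qed (simp add: inner_right_distrib)
    finally show ?thesis unfolding W0_def by simp
  qed
  then show ?thesis unfolding fibre_model_def
    using L n' TS' orthonormal_pair_axioms by blast
qed

lemma TS_subspace:
  assumes "q \<in> \<Sigma>"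
  shows "subspace (TS q)"
proof -
  obtain L u v where F: "fibre_model q L u v" using ex_fibre_model[OF assms] by blast
  note L = fibre_modelD[OF F]
  let ?f = "\<lambda>x :: real \<times> real. fst x *\<^sub>R u + snd x *\<^sub>R v"
  have "linear ?f" by (rule linearI) (simp_all add: algebra_simps)
  then have "linear (\<lambda>x. L (?f x))"
    using linear_compose[of ?f L] G2_isoD(1)[OF L(1)] by (simp add: o_def)
  then have "subspace (range (\<lambda>x. L (?f x)))" by (rule linear_subspace_image[OF _ subspace_UNIV])
  moreover have "TS q = range (\<lambda>x. L (?f x))" unfolding L(4) image_def by force
  ultimately show ?thesis by (simp only:)
qed

lemma W_subspace:
  assumes "q \<in> \<Sigma>"
  shows "subspace (W q)"
proof -
  obtain L u v where F: "fibre_model q L u v" using ex_fibre_model[OF assms] by blast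
  note L = fibre_modelD[OF F]
  interpret orthonormal_pair u v by (rule L(2))
  have "w \<in> W q \<Longrightarrow> w \<in> L ` W0" for w
    using G2_iso_surj[OF L(1) W_tangent] L(5) by blast
  then have eq: "W q = L ` W0" using L(5) by blast
  have "subspace W0" by (rule subspaceI) (use W0_subspace in \<open>auto simp: W0_def inner_left_distrib\<close>)
  then show ?thesis unfolding eq by (rule linear_subspace_image[OF G2_isoD(1)[OF L(1)]])
qed

lemma eta_unit_normal:
  assumes "q \<in> \<Sigma>"
  shows "\<eta> q \<in> T q" "g q (\<eta> q) (\<eta> q) = 1" "t \<in> TS q \<Longrightarrow> g q t (\<eta> q) = 0"
proof -
  obtain L u v where F: "fibre_model q L u v" using ex_fibre_model[OF assms] by blast
  note L = fibre_modelD[OF F]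
  interpret orthonormal_pair u v by (rule L(2))
  show "\<eta> q \<in> T q" unfolding L(3) by (rule G2_isoD(3)[OF L(1)])
  show "g q (\<eta> q) (\<eta> q) = 1" unfolding L(3) G2_isoD(4)[OF L(1)] by (rule n_orth)
  assume "t \<in> TS q"
  then obtain \<alpha> \<beta> where t: "t = L (\<alpha> *\<^sub>R u + \<beta> *\<^sub>R v)" unfolding L(4) by blast
  show "g q t (\<eta> q) = 0"
    unfolding t L(3) G2_isoD(4)[OF L(1)] by (simp add: inner_left_distrib n_orth)
qed

lemma J_W_closed:
  assumes "q \<in> \<Sigma>" "w \<in> W q"
  shows "J q w \<in> W q"
proof -
  obtain L u v where F: "fibre_model q L u v" using ex_fibre_model[OF assms(1)] by blast
  note L = fibre_modelD[OF F]
  interpret orthonormal_pair u v by (rule L(2))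
  obtain x where x: "w = L x" using G2_iso_surj[OF L(1) W_tangent[OF assms(2)]] by blast
  show ?thesis using assms(2) unfolding x L(6) L(5) by (rule W0_cross)
qed

lemma proj_W:
  assumes "q \<in> \<Sigma>" "z \<in> T q"
  defines "y \<equiv> orth_proj (g q) (W q) z"
  shows "y \<in> W q" "w \<in> W q \<Longrightarrow> g q y w = g q z w" "w \<in> W q \<Longrightarrow> \<phi> q (\<eta> q) y w = \<phi> q (\<eta> q) z w"
proof -
  obtain L u v where F: "fibre_model q L u v" using ex_fibre_model[OF assms(1)] by blast
  note L = fibre_modelD[OF F]
  interpret orthonormal_pair u v by (rule L(2))
  obtain x where x: "z = L x" using G2_iso_surj[OF L(1) assms(2)] by blast
  have orth: "g q (z - L (proj0 x)) w = 0" "\<phi> q (\<eta> q) (L (proj0 x)) w = \<phi> q (\<eta> q) z w" if w: "w \<in> W q" for w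
  proof -
    obtain e where e: "w = L e" using G2_iso_surj[OF L(1) W_tangent[OF w]] by blast
    have eW: "e \<in> W0" using w unfolding e L(5) .
    show "g q (z - L (proj0 x)) w = 0"
      unfolding x e linear_diff[OF G2_isoD(1)[OF L(1)], symmetric] G2_isoD(4)[OF L(1)]
      by (rule proj0(2)[OF eW])
    show "\<phi> q (\<eta> q) (L (proj0 x)) w = \<phi> q (\<eta> q) z w"
      unfolding x e L(3) G2_isoD(5)[OF L(1)] by (rule proj0(3)[OF eW])
  qed
  have "L (proj0 x) \<in> W q" unfolding L(5) by (rule proj0(1))
  moreover have "W q \<subseteq> T q" using W_tangent by blast
  ultimately have y: "y = L (proj0 x)"
    unfolding y_def by (intro orth_proj_eqI W_subspace assms(1,2) orth)
  show yW: "y \<in> W q" unfolding y by fact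
  show "w \<in> W q \<Longrightarrow> g q y w = g q z w"
    using orth(1)[of w] g_diff_left[OF W_tangent assms(2) W_tangent[OF yW], of w] unfolding y by simp
  show "w \<in> W q \<Longrightarrow> \<phi> q (\<eta> q) y w = \<phi> q (\<eta> q) z w"
    unfolding y by (rule orth)
qed

lemma phi_W_iff:
  assumes "q \<in> \<Sigma>" "x \<in> T q" "g q x (\<eta> q) = 0"
  shows "(\<forall>s\<in>W q. \<forall>t\<in>W q. \<phi> q x s t = 0) \<longleftrightarrow> (\<forall>t\<in>TS q. g q x t = 0)"
proof -
  obtain L u v where F: "fibre_model q L u v" using ex_fibre_model[OF assms(1)] by blast
  note L = fibre_modelD[OF F]
  interpret orthonormal_pair u v by (rule L(2))
  obtain y where y: "x = L y" using G2_iso_surj[OF L(1) assms(2)] by blast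
  have n: "y \<bullet> n = 0" using assms(3) unfolding y L(3) G2_isoD(4)[OF L(1)] .
  have "(\<forall>s\<in>W q. \<forall>t\<in>W q. \<phi> q x s t = 0) \<longleftrightarrow> (\<forall>s\<in>W0. \<forall>t\<in>W0. \<phi> q x (L s) (L t) = 0)"
    using L(5) G2_iso_surj[OF L(1) W_tangent] by metis
  also have "\<dots> \<longleftrightarrow> y \<bullet> u = 0 \<and> y \<bullet> v = 0"
    unfolding y G2_isoD(5)[OF L(1)] by (rule phi0_W0_iff[OF n])
  also have "\<dots> \<longleftrightarrow> (\<forall>\<alpha> \<beta>. y \<bullet> (\<alpha> *\<^sub>R u + \<beta> *\<^sub>R v) = 0)"
  proof
    assume *: "\<forall>\<alpha> \<beta>. y \<bullet> (\<alpha> *\<^sub>R u + \<beta> *\<^sub>R v) = 0"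
    show "y \<bullet> u = 0 \<and> y \<bullet> v = 0" using *[rule_format, of 1 0] *[rule_format, of 0 1] by simp
  qed (simp add: inner_right_distrib)
  also have "\<dots> \<longleftrightarrow> (\<forall>t\<in>TS q. g q x t = 0)"
    unfolding L(4) y G2_isoD(4)[OF L(1), symmetric] by blast
  finally show ?thesis .
qed

text \<open>Removing the tangential part changes neither the \<open>\<eta>\<close>-component nor the \<open>W\<close>-component, and then
  only the \<open>\<eta>\<close>-component separates a vector from \<open>W\<close>.\<close>

lemma normal_part_in_W_iff:
  assumes "q \<in> \<Sigma>" "z \<in> T q"
  shows "z - orth_proj (g q) (TS q) z \<in> W q \<longleftrightarrow> g q z (\<eta> q) = 0"
proof -
  obtain L u v where F: "fibre_model q L u v" using ex_fibre_model[OF assms(1)] by blast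
  note L = fibre_modelD[OF F]
  interpret orthonormal_pair u v by (rule L(2))
  obtain x where x: "z = L x" using G2_iso_surj[OF L(1) assms(2)] by blast
  define y where "y = (x \<bullet> u) *\<^sub>R u + (x \<bullet> v) *\<^sub>R v"
  have xy: "(x - y) \<bullet> u = 0" "(x - y) \<bullet> v = 0" "(x - y) \<bullet> n = x \<bullet> n"
    unfolding y_def by (simp_all add: inner_diff_left inner_left_distrib uv n_orth inner_commute[of v u])
  have "orth_proj (g q) (TS q) z = L y"
  proof (rule orth_proj_eqI[OF TS_subspace[OF assms(1)] _ assms(2)])
    show "TS q \<subseteq> T q" using TS_tangent by blast
    show "L y \<in> TS q" unfolding L(4) y_def by blast
    fix e assume "e \<in> TS q"
    then obtain \<alpha> \<beta> where e: "e = L (\<alpha> *\<^sub>R u + \<beta> *\<^sub>R v)" unfolding L(4) by blast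
    show "g q (z - L y) e = 0"
      unfolding x e linear_diff[OF G2_isoD(1)[OF L(1)], symmetric] G2_isoD(4)[OF L(1)]
      by (simp add: inner_right_distrib xy)
  qed
  then have "z - orth_proj (g q) (TS q) z = L (x - y)"
    by (simp only: x linear_diff[OF G2_isoD(1)[OF L(1)]])
  then have "z - orth_proj (g q) (TS q) z \<in> W q \<longleftrightarrow> x - y \<in> W0" by (simp only: L(5))
  also have "\<dots> \<longleftrightarrow> x \<bullet> n = 0" unfolding W0_def by (simp add: xy)
  also have "\<dots> \<longleftrightarrow> g q z (\<eta> q) = 0" unfolding x L(3) G2_isoD(4)[OF L(1)] ..
  finally show ?thesis .
qed

section \<open>The second fundamental form and the derivative of the complex structure\<close>

text \<open>All fields that have to be differentiated are built from an adapted frame \<open>E\<close> and an extension \<open>N\<close> of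
  \<open>\<eta>\<close>; they are bundled so that they can be restricted to smaller neighbourhoods together.\<close>

definition normal_frame where
  "normal_frame U E N \<longleftrightarrow> open U \<and> orthonormal_fields U 7 E \<and> vector_field A U N \<and>
     (\<forall>q\<in>\<Sigma> \<inter> U. N q = \<eta> q \<and> adapted q (E 1 q) (E 2 q))"

lemma normal_frameD:
  assumes "normal_frame U E N"
  shows "open U" "orthonormal_fields U 7 E" "vector_field A U N"
    "q \<in> \<Sigma> \<Longrightarrow> q \<in> U \<Longrightarrow> N q = \<eta> q" "q \<in> \<Sigma> \<Longrightarrow> q \<in> U \<Longrightarrow> adapted q (E 1 q) (E 2 q)"
  using assms unfolding normal_frame_def by blast+

lemma ex_normal_frame:
  assumes "p \<in> \<Sigma>"
  shows "\<exists>U E N. p \<in> U \<and> normal_frame U E N"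
proof -
  obtain U E where U: "open U" "p \<in> U" and E: "orthonormal_fields U 7 E"
    and a: "\<forall>q\<in>\<Sigma> \<inter> U. adapted q (E 1 q) (E 2 q)" using adapted_frame[OF assms] by blast
  have "vector_field A U (\<lambda>q. cr q (E 1 q) (E 2 q))"
    by (rule vector_field_cross[OF U(1) E]) (rule orthonormal_fieldsD(1)[OF E], simp)+
  moreover have "cr q (E 1 q) (E 2 q) = \<eta> q" if "q \<in> \<Sigma> \<inter> U" for q
    using a[rule_format, OF that] unfolding adapted_def by simp
  ultimately have "normal_frame U E (\<lambda>q. cr q (E 1 q) (E 2 q))"
    unfolding normal_frame_def using U(1) E a by blast
  then show ?thesis using U(2) by blast
qed

lemma normal_frame_subset:
  assumes "normal_frame U E N" "open U'" "U' \<subseteq> U"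
  shows "normal_frame U' E N"
  unfolding normal_frame_def
  using normal_frameD[OF assms(1)] orthonormal_fields_subset[OF normal_frameD(2)[OF assms(1)] assms(3)]
    vector_field_subset[OF normal_frameD(3)[OF assms(1)] assms(3)] assms(2,3) by blast

text \<open>The function \<open>g(N, N)\<close> is constant along the surface, although \<open>N\<close> need not be a unit field off it.\<close>

lemma D_normal_orthogonal_normal:
  assumes N: "normal_frame U E N" and p: "p \<in> \<Sigma>" "p \<in> U" and v: "v \<in> TS p"
  shows "g p (D p v N) (\<eta> p) = 0"
proof -
  note n = normal_frameD[OF N]
  note vT = TS_tangent[OF v]
  have DT: "D p v N \<in> T p" by (rule D_tangent[OF n(1,3) p(2) vT])
  have "dir_deriv A p v (\<lambda>q. g q (N q) (N q)) = dir_deriv A p v (\<lambda>q. 1)"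
    by (rule dir_deriv_agree[OF g_smooth[OF n(1,3,3)] smooth_fun_const n(1) p(2,1) v])
      (use n(4) eta_unit_normal(2) in auto)
  also have "\<dots> = 0" by (simp add: dir_deriv_def Let_def)
  finally have "g p (D p v N) (\<eta> p) + g p (\<eta> p) (D p v N) = 0"
    unfolding D_metric[OF n(1,3,3) p(2) vT] n(4)[OF p] .
  then show ?thesis using g_sym[OF DT eta_unit_normal(1)[OF p(1)]] by simp
qed

lemma ex_tangent_section:
  assumes p: "p \<in> \<Sigma>" and w: "w \<in> TS p"
  shows "\<exists>Y. Y p = w \<and> (\<exists>U. open U \<and> p \<in> U \<and> section_along A \<Sigma> TS U Y)"
proof -
  obtain c where c: "slice_chart A \<Sigma> c" "p \<in> fst c" using ex_slice_chart[OF p] by blast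
  note cA = slice_chartD(1)[OF c(1)]
  define Y where "Y q = tvec_of c q (w c)" for q
  have Y: "vector_field A (fst c) Y" unfolding Y_def by (rule vector_field_tvec_of[OF cA chart_open[OF cA] order_refl])
  have "Y q \<in> TS q" if "q \<in> \<Sigma> \<inter> fst c" for q
  proof -
    have q: "q \<in> fst c" "q \<in> \<Sigma>" using that by blast+
    have "Y q c = w c" unfolding Y_def by (rule tvec_of_self[OF cA q(1)])
    moreover have "in_plane (w c)" using TS_chart[OF c p] w by blast
    ultimately show ?thesis unfolding TS_chart[OF c(1) q] using vector_field_tangent[OF Y q(1)] by simp
  qed
  moreover have "extends_near A \<Sigma> q Y Y" if "q \<in> \<Sigma> \<inter> fst c" for q
    by (rule extends_nearI[OF chart_open[OF cA] _ Y]) (use that in auto)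
  ultimately have "section_along A \<Sigma> TS (fst c) Y" unfolding section_along_def by blast
  moreover have "Y p = w" unfolding Y_def by (rule tvec_of_comp[OF cA c(2) TS_tangent[OF w]])
  ultimately show ?thesis using chart_open[OF cA] c(2) by blast
qed

text \<open>The derivative of \<open>g(Y, \<eta>) = 0\<close> along \<open>v\<close>, for the field \<open>Y\<close> with \<open>Y p = w\<close> chosen in the definition
  of the second fundamental form. The resulting formula for the
  component along \<open>\<eta>\<close> depends on \<open>Y\<close> only through \<open>w\<close>.\<close>

lemma second_fundamental_form_in_W_iff:
  assumes N: "normal_frame U E N" and p: "p \<in> \<Sigma>" "p \<in> U" and v: "v \<in> TS p" and w: "w \<in> TS p"
  shows "second_fundamental_form A g D \<Sigma> p v w \<in> W p \<longleftrightarrow> g p (D p v N) w = 0"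
proof -
  note vT = TS_tangent[OF v]
  define Y where "Y = (SOME Y. Y p = w \<and> (\<exists>U. open U \<and> p \<in> U \<and> section_along A \<Sigma> TS U Y))"
  have "Y p = w \<and> (\<exists>U. open U \<and> p \<in> U \<and> section_along A \<Sigma> TS U Y)"
    unfolding Y_def by (rule someI_ex[OF ex_tangent_section[OF p(1) w]])
  then obtain U1 where Yp: "Y p = w" and U1: "open U1" "p \<in> U1" and Y: "section_along A \<Sigma> TS U1 Y"
    by blast
  obtain S where S: "extends_near A \<Sigma> p Y S" using Y p(1) U1(2) unfolding section_along_def by blast
  obtain U2 where U2: "open U2" "p \<in> U2" "vector_field A U2 S" "\<And>q. q \<in> \<Sigma> \<inter> U2 \<Longrightarrow> S q = Y q"
    by (rule extends_nearD[OF S]) (rule that)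
  define V where "V = U \<inter> U1 \<inter> U2"
  have V: "open V" "p \<in> V" "V \<subseteq> U" unfolding V_def using normal_frameD(1)[OF N] U1 U2 p(2) by auto
  note n = normal_frameD[OF normal_frame_subset[OF N V(1,3)]]
  have SV: "vector_field A V S" by (rule vector_field_subset[OF U2(3)]) (auto simp: V_def)
  have DT: "D p v S \<in> T p" "D p v N \<in> T p"
    by (rule D_tangent[OF V(1) SV V(2) vT] D_tangent[OF V(1) n(3) V(2) vT])+
  have Sp: "S p = w" using U2(4)[of p] p(1) U2(2) Yp by simp
  have "g q (S q) (N q) = 0" if "q \<in> \<Sigma> \<inter> V" for q
  proof -
    have "S q \<in> TS q" using U2(4)[of q] Y that unfolding section_along_def V_def by auto
    then show ?thesis using eta_unit_normal(3)[of q "S q"] n(4)[of q] that by simp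
  qed
  then have "dir_deriv A p v (\<lambda>q. g q (S q) (N q)) = dir_deriv A p v (\<lambda>q. 0)"
    by (rule dir_deriv_agree[OF g_smooth[OF V(1) SV n(3)] smooth_fun_const V(1,2) p(1) v])
  also have "\<dots> = 0" by (simp add: dir_deriv_def Let_def)
  finally have "g p (D p v S) (\<eta> p) + g p w (D p v N) = 0"
    unfolding D_metric[OF V(1) SV n(3) V(2) vT] n(4)[OF p(1) V(2)] Sp .
  then have *: "g p (D p v S) (\<eta> p) = 0 \<longleftrightarrow> g p (D p v N) w = 0"
    using g_sym[OF TS_tangent[OF w] DT(2)] by linarith
  have "second_fundamental_form A g D \<Sigma> p v w = D p v S - orth_proj (g p) (TS p) (D p v S)"
    unfolding second_fundamental_form_def Let_def Y_def[symmetric] nabla_X_eq[OF p(1) v S] ..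
  then show ?thesis using normal_part_in_W_iff[OF p(1) DT(1)] * by simp
qed

text \<open>Let \<open>S\<close>, \<open>R\<close> and \<open>Z\<close> extend \<open>s\<close>, \<open>\<J> s\<close> and \<open>t\<close>. On the surface \<open>g(R, Z) = \<phi>(N, S, Z)\<close>; differentiating
  both sides, the terms with \<open>D\<^sub>v Z\<close> cancel. The term \<open>\<phi>(\<eta>, D\<^sub>v S, t)\<close> is the contribution of
  \<open>\<J>(\<nabla>\<^sup>W\<^sub>v s)\<close>, because the part of \<open>D\<^sub>v S\<close> orthogonal to \<open>W\<close> does not contribute to it, and what is
  left is \<open>\<phi>(D\<^sub>v N, s, t)\<close>.\<close>

lemma nabla_W_J_pairing:
  assumes N: "normal_frame U0 E N" and p: "p \<in> \<Sigma>" "p \<in> U0" and v: "v \<in> TS p"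
    and s: "section_along A \<Sigma> W U s" "p \<in> U"
  defines "d \<equiv> nabla_W A \<phi> g D \<Sigma> Or p v (\<lambda>q. J q (s q)) - J p (nabla_W A \<phi> g D \<Sigma> Or p v s)"
  shows "d \<in> W p" and "t \<in> W p \<Longrightarrow> g p d t = \<phi> p (D p v N) (s p) t"
proof -
  note vT = TS_tangent[OF v]
  obtain S where S: "extends_near A \<Sigma> p s S" using s p(1) unfolding section_along_def by blast
  obtain U2 where U2: "open U2" "p \<in> U2" "vector_field A U2 S" "\<And>q. q \<in> \<Sigma> \<inter> U2 \<Longrightarrow> S q = s q"
    by (rule extends_nearD[OF S]) (rule that)
  define V where "V = U0 \<inter> U2"
  have V: "open V" "p \<in> V" "V \<subseteq> U0" unfolding V_def using normal_frameD(1)[OF N] U2 p(2) by auto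
  note NV = normal_frame_subset[OF N V(1,3)]
  have SV: "vector_field A V S" by (rule vector_field_subset[OF U2(3)]) (auto simp: V_def)
  define R where "R q = cr q (N q) (S q)" for q
  have R: "vector_field A V R"
    unfolding R_def by (rule vector_field_cross[OF V(1) normal_frameD(2,3)[OF NV] SV])
  have "R q = J q (s q)" if "q \<in> \<Sigma> \<inter> V" for q
    using normal_frameD(4)[OF NV, of q] U2(4)[of q] that unfolding R_def J_W_def V_def by simp
  then have RJ: "extends_near A \<Sigma> p (\<lambda>q. J q (s q)) R" by (rule extends_nearI[OF V(1,2) R])
  have Sp: "S p = s p" using U2(4)[of p] p(1) U2(2) by simp
  note Np = normal_frameD(4)[OF NV p(1) V(2)]
  have sW: "s p \<in> W p" using s p(1) unfolding section_along_def by blast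
  note sT = W_tangent[OF sW] and \<eta>T = eta_unit_normal(1)[OF p(1)]
  have DT: "D p v S \<in> T p" "D p v R \<in> T p" "D p v N \<in> T p"
    by (rule D_tangent[OF V(1) SV V(2) vT] D_tangent[OF V(1) R V(2) vT]
        D_tangent[OF V(1) normal_frameD(3)[OF NV] V(2) vT])+
  note pS = proj_W[OF p(1) DT(1)] and pR = proj_W[OF p(1) DT(2)]
  define y where "y = orth_proj (g p) (W p) (D p v S)"
  note pS = pS[folded y_def]
  have d: "d = orth_proj (g p) (W p) (D p v R) - J p y"
    unfolding d_def y_def nabla_W_def nabla_X_eq[OF p(1) v S] nabla_X_eq[OF p(1) v RJ] ..
  note JyW = J_W_closed[OF p(1) pS(1)]
  show "d \<in> W p" unfolding d by (rule subspace_diff[OF W_subspace[OF p(1)] pR(1) JyW])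
  assume t: "t \<in> W p"
  note tT = W_tangent[OF t]
  obtain V' Z where V': "open V'" "p \<in> V'" "V' \<subseteq> V" and Z: "vector_field A V' Z" and Zp: "Z p = t"
    using ex_vector_field[OF tT V(2,1)] by blast
  have fields: "vector_field A V' S" "vector_field A V' R" "vector_field A V' N"
    by (rule vector_field_subset[OF SV V'(3)] vector_field_subset[OF R V'(3)]
        vector_field_subset[OF normal_frameD(3)[OF NV] V'(3)])+
  have ZT: "D p v Z \<in> T p" by (rule D_tangent[OF V'(1) Z V'(2) vT])
  have cross_phi: "g q (cr q a b) z = \<phi> q a b z" if "a \<in> T q" "b \<in> T q" "z \<in> T q" for q a b z
    using g_cross[OF that(3,1,2)] g_sym[OF cross_tangent[OF that(1,2)] that(3)] phi_rotate[OF that(3,1,2)] by simp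
  have "dir_deriv A p v (\<lambda>q. g q (R q) (Z q)) = dir_deriv A p v (\<lambda>q. \<phi> q (N q) (S q) (Z q))"
  proof (rule dir_deriv_agree[OF g_smooth[OF V'(1) fields(2) Z] phi_smooth[OF V'(1) fields(3,1) Z] V'(1,2) p(1) v])
    fix q assume "q \<in> \<Sigma> \<inter> V'"
    then have q: "q \<in> V'" by blast
    show "g q (R q) (Z q) = \<phi> q (N q) (S q) (Z q)"
      unfolding R_def by (rule cross_phi; rule vector_field_tangent[OF _ q], rule fields Z)
  qed
  then have "g p (D p v R) t + g p (cr p (\<eta> p) (s p)) (D p v Z) =
      \<phi> p (D p v N) (s p) t + \<phi> p (\<eta> p) (D p v S) t + \<phi> p (\<eta> p) (s p) (D p v Z)"
    unfolding D_metric[OF V'(1) fields(2) Z V'(2) vT] D_phi[OF V'(1) fields(3,1) Z V'(2) vT] Zp R_def[of p] Np Sp .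
  then have 1: "g p (D p v R) t = \<phi> p (D p v N) (s p) t + \<phi> p (\<eta> p) (D p v S) t"
    unfolding cross_phi[OF \<eta>T sT ZT] by simp
  have 2: "g p (J p y) t = \<phi> p (\<eta> p) (D p v S) t"
    unfolding J_W_def cross_phi[OF \<eta>T W_tangent[OF pS(1)] tT] by (rule pS(3)[OF t])
  show "g p d t = \<phi> p (D p v N) (s p) t"
    unfolding d g_diff_left[OF tT W_tangent[OF pR(1)] W_tangent[OF JyW]] pR(2)[OF t] 1 2 by simp
qed

text \<open>Subtract from a vector field extending \<open>w\<close> its components along \<open>E 1\<close>, \<open>E 2\<close> and \<open>N\<close>. At \<open>p\<close> these vanish, so
  the value there is unchanged.\<close>

lemma ex_W_section:
  assumes p: "p \<in> \<Sigma>" and w: "w \<in> W p"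
  shows "\<exists>U s. open U \<and> p \<in> U \<and> section_along A \<Sigma> W U s \<and> s p = w"
proof -
  obtain U0 E N where p0: "p \<in> U0" and N0: "normal_frame U0 E N" using ex_normal_frame[OF p] by blast
  obtain U Z where U: "open U" "p \<in> U" "U \<subseteq> U0" and Z: "vector_field A U Z" and Zp: "Z p = w"
    using ex_vector_field[OF W_tangent[OF w] p0 normal_frameD(1)[OF N0]] by blast
  note n = normal_frameD[OF normal_frame_subset[OF N0 U(1,3)]]
  have E: "vector_field A U (E 1)" "vector_field A U (E 2)" by (rule orthonormal_fieldsD(1)[OF n(2)], simp)+
  define s where "s q = Z q - g q (Z q) (E 1 q) *\<^sub>R E 1 q - g q (Z q) (E 2 q) *\<^sub>R E 2 q - g q (Z q) (N q) *\<^sub>R N q" for q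
  have sf: "vector_field A U s"
    unfolding s_def
    by (rule vector_field_diff[OF U(1) vector_field_diff[OF U(1) vector_field_diff[OF U(1) Z
        vector_field_scaleR[OF U(1) g_smooth[OF U(1) Z E(1)] E(1)]]
        vector_field_scaleR[OF U(1) g_smooth[OF U(1) Z E(2)] E(2)]]
        vector_field_scaleR[OF U(1) g_smooth[OF U(1) Z n(3)] n(3)]])
  have "s q \<in> W q" if "q \<in> \<Sigma> \<inter> U" for q
  proof -
    have q: "q \<in> \<Sigma>" "q \<in> U" using that by blast+
    define a b m z where "a = E 1 q" and "b = E 2 q" and "m = N q" and "z = Z q"
    have ad: "adapted q a b" unfolding a_def b_def by (rule n(5)[OF q])
    have m: "m = \<eta> q" unfolding m_def by (rule n(4)[OF q])
    have abT: "a \<in> T q" "b \<in> T q" and on: "g q a a = 1" "g q b b = 1" "g q a b = 0"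
      and TSab: "TS q = {\<alpha> *\<^sub>R a + \<beta> *\<^sub>R b | \<alpha> \<beta>. True}"
      using ad unfolding adapted_def by blast+
    have mT: "m \<in> T q" and mm: "g q m m = 1" unfolding m by (rule eta_unit_normal[OF q(1)])+
    have zT: "z \<in> T q" unfolding z_def by (rule vector_field_tangent[OF Z q(2)])
    have "a = 1 *\<^sub>R a + 0 *\<^sub>R b" "b = 0 *\<^sub>R a + 1 *\<^sub>R b"
      by (simp_all only: scaleR_one scaleR_zero_left add_0_right add_0_left)
    then have abTS: "a \<in> TS q" "b \<in> TS q" unfolding TSab by blast+
    have am: "g q a m = 0" "g q b m = 0"
      unfolding m by (rule eta_unit_normal(3)[OF q(1) abTS(1)] eta_unit_normal(3)[OF q(1) abTS(2)])+
    then have ma: "g q m a = 0" "g q m b = 0" "g q b a = 0"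
      using g_sym[OF mT abT(1)] g_sym[OF mT abT(2)] g_sym[OF abT] on by simp_all
    have sq: "s q = z - g q z a *\<^sub>R a - g q z b *\<^sub>R b - g q z m *\<^sub>R m"
      unfolding s_def a_def b_def m_def z_def ..
    have sc: "g q z a *\<^sub>R a \<in> T q" "g q z b *\<^sub>R b \<in> T q" "g q z m *\<^sub>R m \<in> T q"
      by (intro tangent_closed(3) abT mT)+
    have gs: "g q (s q) x = g q z x - g q z a * g q a x - g q z b * g q b x - g q z m * g q m x" if x: "x \<in> T q" for x
      unfolding sq g_diff_left[OF x tangent_closed(2)[OF tangent_closed(2)[OF zT sc(1)] sc(2)] sc(3)]
        g_diff_left[OF x tangent_closed(2)[OF zT sc(1)] sc(2)] g_diff_left[OF x zT sc(1)]
        g_scale_left[OF x abT(1)] g_scale_left[OF x abT(2)] g_scale_left[OF x mT] ..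
    have sT: "s q \<in> T q" by (rule vector_field_tangent[OF sf q(2)])
    have o: "g q (s q) a = 0" "g q (s q) b = 0" "g q (s q) m = 0"
      unfolding gs[OF abT(1)] gs[OF abT(2)] gs[OF mT] by (simp_all add: on mm am ma)
    have "g q (s q) t = 0" if "t \<in> TS q" for t
    proof -
      obtain \<alpha> \<beta> where t: "t = \<alpha> *\<^sub>R a + \<beta> *\<^sub>R b" using \<open>t \<in> TS q\<close> unfolding TSab by blast
      show ?thesis
        unfolding t g_add_right[OF sT tangent_closed(3)[OF abT(1)] tangent_closed(3)[OF abT(2)]]
          g_scale_right[OF sT abT(1)] g_scale_right[OF sT abT(2)] o by simp
    qed
    then show ?thesis unfolding W_fibre_def m[symmetric] using sT o(3) by blast
  qed
  moreover have "extends_near A \<Sigma> q s s" if "q \<in> \<Sigma> \<inter> U" for q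
    by (rule extends_nearI[OF U(1) _ sf]) (use that in auto)
  ultimately have "section_along A \<Sigma> W U s" unfolding section_along_def by blast
  moreover have "s p = w"
  proof -
    have ad: "adapted p (E 1 p) (E 2 p)" by (rule n(5)[OF p U(2)])
    then have TSab: "TS p = {\<alpha> *\<^sub>R E 1 p + \<beta> *\<^sub>R E 2 p | \<alpha> \<beta>. True}" unfolding adapted_def by blast
    have "E 1 p = 1 *\<^sub>R E 1 p + 0 *\<^sub>R E 2 p" "E 2 p = 0 *\<^sub>R E 1 p + 1 *\<^sub>R E 2 p"
      by (simp_all only: scaleR_one scaleR_zero_left add_0_right add_0_left)
    then have "E 1 p \<in> TS p" "E 2 p \<in> TS p" unfolding TSab by blast+
    then have "g p w (E 1 p) = 0" "g p w (E 2 p) = 0" "g p w (N p) = 0"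
      using w unfolding n(4)[OF p U(2)] W_fibre_def by blast+
    then show ?thesis unfolding s_def Zp by (simp only: scaleR_zero_left diff_zero)
  qed
  ultimately show ?thesis using U(1,2) by blast
qed

text \<open>Both conditions are statements about \<open>D\<^sub>v N\<close> at a single point: the Hermitian condition because
  every vector of \<open>W\<close> is the value of a local section, the condition on the second fundamental
  form by the derivative of \<open>g(Y, \<eta>) = 0\<close>.\<close>

lemma hermitian_iff:
  "nabla_W_hermitian A \<phi> g D \<Sigma> Or \<longleftrightarrow>
    (\<forall>p\<in>\<Sigma>. \<forall>v\<in>TS p. \<forall>w\<in>TS p. second_fundamental_form A g D \<Sigma> p v w \<in> W p)"
proof -
  have key: "(\<forall>s\<in>W p. \<forall>t\<in>W p. \<phi> p (D p v N) s t = 0) \<longleftrightarrow>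
      (\<forall>w\<in>TS p. second_fundamental_form A g D \<Sigma> p v w \<in> W p)"
    if N: "normal_frame U E N" and p: "p \<in> \<Sigma>" "p \<in> U" and v: "v \<in> TS p" for U E N p v
    using phi_W_iff[OF p(1) D_tangent[OF normal_frameD(1,3)[OF N] p(2) TS_tangent[OF v]]
        D_normal_orthogonal_normal[OF N p v]] second_fundamental_form_in_W_iff[OF N p v] by blast
  show ?thesis
  proof
    assume H: "nabla_W_hermitian A \<phi> g D \<Sigma> Or"
    show "\<forall>p\<in>\<Sigma>. \<forall>v\<in>TS p. \<forall>w\<in>TS p. second_fundamental_form A g D \<Sigma> p v w \<in> W p"
    proof (rule ballI, rule ballI)
      fix p v assume p: "p \<in> \<Sigma>" and v: "v \<in> TS p"
      obtain U0 E N where p0: "p \<in> U0" and N: "normal_frame U0 E N" using ex_normal_frame[OF p] by blast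
      have "\<phi> p (D p v N) s0 t = 0" if s0: "s0 \<in> W p" and t: "t \<in> W p" for s0 t
      proof -
        obtain U s where U: "open U" "p \<in> U" and s: "section_along A \<Sigma> W U s" "s p = s0"
          using ex_W_section[OF p s0] by blast
        have 0: "nabla_W A \<phi> g D \<Sigma> Or p v (\<lambda>q. J q (s q)) - J p (nabla_W A \<phi> g D \<Sigma> Or p v s) = 0"
          by (rule H[unfolded nabla_W_hermitian_def, rule_format, OF conjI[OF U(1) s(1)] IntI[OF p U(2)] v])
        have "g p 0 t = 0" using g_scale_left[OF W_tangent[OF t] W_tangent[OF t], of 0] by simp
        then show ?thesis using nabla_W_J_pairing(2)[OF N p p0 v s(1) U(2) t] unfolding 0 s(2) by simp
      qed
      then show "\<forall>w\<in>TS p. second_fundamental_form A g D \<Sigma> p v w \<in> W p"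
        using key[OF N p p0 v] by blast
    qed
  next
    assume B: "\<forall>p\<in>\<Sigma>. \<forall>v\<in>TS p. \<forall>w\<in>TS p. second_fundamental_form A g D \<Sigma> p v w \<in> W p"
    show "nabla_W_hermitian A \<phi> g D \<Sigma> Or"
      unfolding nabla_W_hermitian_def
    proof (intro allI impI ballI)
      fix U s p v
      assume s: "open U \<and> section_along A \<Sigma> W U s" and pU: "p \<in> \<Sigma> \<inter> U" and v: "v \<in> TS p"
      have p: "p \<in> \<Sigma>" "p \<in> U" using pU by blast+
      obtain U0 E N where p0: "p \<in> U0" and N: "normal_frame U0 E N" using ex_normal_frame[OF p(1)] by blast
      have sW: "s p \<in> W p" using s pU unfolding section_along_def by blast
      note d = nabla_W_J_pairing[OF N p(1) p0 v s[THEN conjunct2] p(2)]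
      let ?d = "nabla_W A \<phi> g D \<Sigma> Or p v (\<lambda>q. J q (s q)) - J p (nabla_W A \<phi> g D \<Sigma> Or p v s)"
      have "\<phi> p (D p v N) (s p) ?d = 0" using key[OF N p(1) p0 v] B p(1) v sW d(1) by blast
      then have "g p ?d ?d = 0" using d(2)[OF d(1)] by simp
      then show "?d = 0" using g_pos[OF W_tangent[OF d(1)]] by force
    qed
  qed
qed

end

theorem proposition6p1:
  fixes A :: "('a::{t2_space, second_countable_topology}, 7) chart set"
    and \<phi> :: "'a \<Rightarrow> ('a, 7) tvec \<Rightarrow> ('a, 7) tvec \<Rightarrow> ('a, 7) tvec \<Rightarrow> real"
    and g :: "'a \<Rightarrow> ('a, 7) tvec \<Rightarrow> ('a, 7) tvec \<Rightarrow> real"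
    and D :: "('a, 7) connection"
    and \<Sigma> :: "'a set"
    and Or :: "'a orientation"
  assumes "G2_manifold A \<phi> g D"
    and "surface A \<Sigma>"
    and "orientation A \<Sigma> Or"
  shows "nabla_W_hermitian A \<phi> g D \<Sigma> Or \<longleftrightarrow>
    (\<forall>p\<in>\<Sigma>. \<forall>v\<in>surface_tangent A \<Sigma> p. \<forall>w\<in>surface_tangent A \<Sigma> p.
       second_fundamental_form A g D \<Sigma> p v w \<in> W_fibre A \<phi> g \<Sigma> Or p)"
proof -
  interpret G2_surface A \<phi> g D \<Sigma> Or by unfold_locales (rule assms)+
  show ?thesis by (rule hermitian_iff)
qed

end
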